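(* For any even positive integer $N$, $\tau\in(0,1)$ and $\nu>-1$, and all $x,y\in\mathbb R\setminus\{0\}$, $$S_N(x,y)=S_{N,1}(x,y)+\widetilde S_{N,1}(x,y)+S_{N,2}(x,y),$$ where $$S_{N,1}(x,y):=\frac1\pi\frac1{1-\tau^2}|xy|^{\nu/2}K_{\nu/2}\Big(\frac{|x|}{1-\tau^2}\Big)e^{\frac{\tau}{1-\tau^2}x}\Big[\tau y\,K_{\nu/2}\Big(\frac{|y|}{1-\tau^2}\Big)+|y|\,K_{\nu/2+1}\Big(\frac{|y|}{1-\tau^2}\Big)\Big]e^{\frac{\tau}{1-\tau^2}y}\,\mathcal K_{N-1}(x,y),$$ $$\widetilde S_{N,1}(x,y):=\frac1\pi\,y\,|xy|^{\nu/2}K_{\nu/2}\Big(\frac{|x|}{1-\tau^2}\Big)K_{\nu/2}\Big(\frac{|y|}{1-\tau^2}\Big)e^{\frac{\tau}{1-\tau^2}(x+y)}\,\partial_y\mathcal K_{N-1}(x,y),$$ $$S_{N,2}(x,y):=\frac1\pi\frac{\tau^{2N-3}}{1-\tau^2}\frac{(N-1)!}{\Gamma(N+\nu-1)}|x|^{\nu/2}K_{\nu/2}\Big(\frac{|x|}{1-\tau^2}\Big)e^{\frac{\tau}{1-\tau^2}x}L_{N-1}^{(\nu)}\Big(\frac x\tau\Big)\int_{\mathbb R}\Big(\frac12-\mathbf 1_{(-\infty,y)}(t)\Big)|t|^{\nu/2}K_{\nu/2}\Big(\frac{|t|}{1-\tau^2}\Big)e^{\frac{\tau}{1-\tau^2}t}L_{N-2}^{(\nu)}\Big(\frac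 t\tau\Big)dt.$$
   Context: $K_\nu$ is the modified Bessel function of the second kind. The generalised Laguerre polynomial is $L_j^{(\nu)}(z):=\sum_{k=0}^j\frac{\Gamma(j+\nu+1)}{(j-k)!\,\Gamma(\nu+k+1)}\frac{(-z)^k}{k!}$, with $L_{-1}^{(\nu)}:=0$. Define polynomials $$p_{2j}(x):=\tau^{2j}(2j)!\,L_{2j}^{(\nu)}(x/\tau),\qquad p_{2j+1}(x):=-\tau^{2j+1}(2j+1)!\,L_{2j+1}^{(\nu)}(x/\tau)+\tau^{2j-1}(2j)!\,(2j+\nu)\,L_{2j-1}^{(\nu)}(x/\tau),$$ functions $$\Phi_j(y):=\int_{\mathbb R}\operatorname{sgn}(y-v)\,|v|^{\nu/2}K_{\nu/2}\Big(\frac{|v|}{1-\tau^2}\Big)\exp\Big(\frac{\tau v}{1-\tau^2}\Big)p_j(v)\,dv,$$ constants $r_j:=2\pi(1-\tau^2)\Gamma(2j+1)\Gamma(2j+1+\nu)$, and $$S_N(x,y):=|x|^{\nu/2}K_{\nu/2}\Big(\frac{|x|}{1-\tau^2}\Big)\exp\Big(\frac{\tau x}{1-\tau^2}\Big)\sum_{j=0}^{N/2-1}\frac{p_{2j+1}(x)\Phi_{2j}(y)-p_{2j}(x)\Phi_{2j+1}(y)}{r_j}.$$ ($S_N$ is the building block of the Pfaffian correlation kernel of the real eigenvalues of the asymmetric Wishart matrix.) Finally, $$\mathcal K_N(x,y):=\sum_{j=0}^{N-1}\frac{j!\,\tau^{2j}}{\Gamma(j+\nu+1)}L_j^{(\nu)}\Big(\frac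 x\tau\Big)L_j^{(\nu)}\Big(\frac y\tau\Big).$$ *)

theory Defs
  imports "HOL-Analysis.Analysis"
begin

text \<open>
  The modified Bessel function of the second kind, for real order and argument \<open>x > 0\<close>, by its
  classical integral representation
  \<open>K\<^sub>\<nu>(x) = \<integral>\<^sub>0\<^sup>\<infinity> e\<^bsup>-x cosh t\<^esup> cosh (\<nu> t) dt\<close>.
  For \<open>x \<le> 0\<close> the integral diverges and the value is the library's default \<open>0\<close>.
\<close>

definition bessel_K :: "real \<Rightarrow> real \<Rightarrow> real" where
  "bessel_K \<nu> x = (LBINT t:{0..}. exp (- x * cosh t) * cosh (\<nu> * t))"

text \<open>The degree is an integer so that the convention \<open>L\<^sub>-\<^sub>1 = 0\<close> can be expressed.\<close>

definition laguerre :: "real \<Rightarrow> int \<Rightarrow> real \<Rightarrow> real" where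
  "laguerre \<nu> j z =
     (if j < 0 then 0
      else \<Sum>k = 0..nat j. Gamma (of_int j + \<nu> + 1) / (fact (nat j - k) * Gamma (\<nu> + of_nat k + 1))
             * ((- z) ^ k / fact k))"

definition weight :: "real \<Rightarrow> real \<Rightarrow> real \<Rightarrow> real" where
  "weight \<nu> \<tau> x = \<bar>x\<bar> powr (\<nu> / 2) * bessel_K (\<nu> / 2) (\<bar>x\<bar> / (1 - \<tau>\<^sup>2)) * exp (\<tau> * x / (1 - \<tau>\<^sup>2))"

definition p_even :: "real \<Rightarrow> real \<Rightarrow> nat \<Rightarrow> real \<Rightarrow> real" where
  "p_even \<nu> \<tau> j x = \<tau> ^ (2 * j) * fact (2 * j) * laguerre \<nu> (2 * int j) (x / \<tau>)"

text \<open>For \<open>j = 0\<close> the exponent \<open>2 j - 1\<close> is \<open>-1\<close>, hence the integer power.\<close>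

definition p_odd :: "real \<Rightarrow> real \<Rightarrow> nat \<Rightarrow> real \<Rightarrow> real" where
  "p_odd \<nu> \<tau> j x =
     - (\<tau> ^ (2 * j + 1)) * fact (2 * j + 1) * laguerre \<nu> (2 * int j + 1) (x / \<tau>)
     + \<tau> powi (2 * int j - 1) * fact (2 * j) * (2 * real j + \<nu>) * laguerre \<nu> (2 * int j - 1) (x / \<tau>)"

definition p_poly :: "real \<Rightarrow> real \<Rightarrow> nat \<Rightarrow> real \<Rightarrow> real" where
  "p_poly \<nu> \<tau> n = (if even n then p_even \<nu> \<tau> (n div 2) else p_odd \<nu> \<tau> (n div 2))"

definition Phi :: "real \<Rightarrow> real \<Rightarrow> nat \<Rightarrow> real \<Rightarrow> real" where
  "Phi \<nu> \<tau> j y = (LBINT v. sgn (y - v) * weight \<nu> \<tau> v * p_poly \<nu> \<tau> j v)"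

definition r_const :: "real \<Rightarrow> real \<Rightarrow> nat \<Rightarrow> real" where
  "r_const \<nu> \<tau> j = 2 * pi * (1 - \<tau>\<^sup>2) * Gamma (2 * real j + 1) * Gamma (2 * real j + 1 + \<nu>)"

definition S_N :: "real \<Rightarrow> real \<Rightarrow> nat \<Rightarrow> real \<Rightarrow> real \<Rightarrow> real" where
  "S_N \<nu> \<tau> N x y =
     weight \<nu> \<tau> x *
     (\<Sum>j<N div 2. (p_poly \<nu> \<tau> (2 * j + 1) x * Phi \<nu> \<tau> (2 * j) y
                     - p_poly \<nu> \<tau> (2 * j) x * Phi \<nu> \<tau> (2 * j + 1) y) / r_const \<nu> \<tau> j)"

definition kernel_K :: "real \<Rightarrow> real \<Rightarrow> nat \<Rightarrow> real \<Rightarrow> real \<Rightarrow> real" where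
  "kernel_K \<nu> \<tau> N x y =
     (\<Sum>j<N. fact j * \<tau> ^ (2 * j) / Gamma (real j + \<nu> + 1)
              * laguerre \<nu> (int j) (x / \<tau>) * laguerre \<nu> (int j) (y / \<tau>))"

definition S_N1 :: "real \<Rightarrow> real \<Rightarrow> nat \<Rightarrow> real \<Rightarrow> real \<Rightarrow> real" where
  "S_N1 \<nu> \<tau> N x y =
     1 / pi * (1 / (1 - \<tau>\<^sup>2)) * \<bar>x * y\<bar> powr (\<nu> / 2)
     * bessel_K (\<nu> / 2) (\<bar>x\<bar> / (1 - \<tau>\<^sup>2)) * exp (\<tau> / (1 - \<tau>\<^sup>2) * x)
     * (\<tau> * y * bessel_K (\<nu> / 2) (\<bar>y\<bar> / (1 - \<tau>\<^sup>2)) + \<bar>y\<bar> * bessel_K (\<nu> / 2 + 1) (\<bar>y\<bar> / (1 - \<tau>\<^sup>2)))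
     * exp (\<tau> / (1 - \<tau>\<^sup>2) * y) * kernel_K \<nu> \<tau> (N - 1) x y"

definition S_N1_tilde :: "real \<Rightarrow> real \<Rightarrow> nat \<Rightarrow> real \<Rightarrow> real \<Rightarrow> real" where
  "S_N1_tilde \<nu> \<tau> N x y =
     1 / pi * y * \<bar>x * y\<bar> powr (\<nu> / 2)
     * bessel_K (\<nu> / 2) (\<bar>x\<bar> / (1 - \<tau>\<^sup>2)) * bessel_K (\<nu> / 2) (\<bar>y\<bar> / (1 - \<tau>\<^sup>2))
     * exp (\<tau> / (1 - \<tau>\<^sup>2) * (x + y)) * deriv (\<lambda>u. kernel_K \<nu> \<tau> (N - 1) x u) y"

definition S_N2 :: "real \<Rightarrow> real \<Rightarrow> nat \<Rightarrow> real \<Rightarrow> real \<Rightarrow> real" where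
  "S_N2 \<nu> \<tau> N x y =
     1 / pi * (\<tau> ^ (2 * N - 3) / (1 - \<tau>\<^sup>2)) * (fact (N - 1) / Gamma (real N + \<nu> - 1))
     * \<bar>x\<bar> powr (\<nu> / 2) * bessel_K (\<nu> / 2) (\<bar>x\<bar> / (1 - \<tau>\<^sup>2)) * exp (\<tau> / (1 - \<tau>\<^sup>2) * x)
     * laguerre \<nu> (int N - 1) (x / \<tau>)
     * (LBINT t. (1 / 2 - indicator {..<y} t) * \<bar>t\<bar> powr (\<nu> / 2)
          * bessel_K (\<nu> / 2) (\<bar>t\<bar> / (1 - \<tau>\<^sup>2)) * exp (\<tau> / (1 - \<tau>\<^sup>2) * t)
          * laguerre \<nu> (int N - 2) (t / \<tau>))"

end

theory Submission
  imports Defs "HOL-Computational_Algebra.Polynomial" "HOL-Real_Asymp.Real_Asymp"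
begin

text \<open>
  Write \<open>c = 1/(1 - \<tau>\<^sup>2)\<close>, \<open>w\<close> for the weight, \<open>f\<^sub>j(y) = L\<^sub>j(y/\<tau>)\<close> and \<open>\<psi>\<^sub>j(y) = \<integral> sgn (y - v) w(v) f\<^sub>j(v) dv\<close>. The functions
  \<open>\<Phi>\<^sub>j\<close> are combinations of the \<open>\<psi>\<^sub>j\<close>, and the whole theorem rests on one identity between the \<open>\<psi>\<^sub>j\<close> and a local
  expression. Put
  \<open>G\<^sub>j(y) = |y|\<^bsup>\<nu>/2\<^esup> e\<^bsup>\<tau> c y\<^esup> c (\<tau> y K\<^bsub>\<nu>/2\<^esub>(c |y|) + |y| K\<^bsub>\<nu>/2+1\<^esub>(c |y|)) f\<^sub>j(y) + y w(y) f\<^sub>j'(y)\<close>.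
  The recurrences for \<open>K\<close>, the Laguerre differential equation and the three-term recurrence combine to
  \<open>G\<^sub>j' = c w (\<tau> (j + 1) f\<^bsub>j+1\<^esub> - ((j + \<nu>)/\<tau>) f\<^bsub>j-1\<^esub>)\<close>
  away from the origin (\<open>laguerre_operator\<close> has the polynomial part of the computation). Since \<open>\<nu> > -1\<close>,
  the function \<open>G\<^sub>j\<close> is continuous at \<open>0\<close> and \<open>w\<close> is integrable there; both decay exponentially. Integrating against
  \<open>sgn (y - v)\<close> therefore yields
  \<open>2 G\<^sub>j = c (\<tau> (j + 1) \<psi>\<^bsub>j+1\<^esub> - ((j + \<nu>)/\<tau>) \<psi>\<^bsub>j-1\<^esub>)\<close> (\<open>integral_sgn_weight_laguerre\<close>).

  For even \<open>j\<close> this says that \<open>\<Phi>\<^bsub>j+1\<^esub>\<close> is a multiple of \<open>G\<^sub>j\<close>, so the products \<open>p\<^bsub>2j\<^esub>(x) \<Phi>\<^bsub>2j+1\<^esub>(y)\<close> are, up to constants, the terms of even index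
  in \<open>S\<^bsub>N,1\<^esub>\<close> and its companion with the derivative of the kernel. For odd \<open>j\<close> it says that the term of odd index is a sum of two of
  the products \<open>f\<^bsub>odd\<^esub>(x) \<psi>\<^bsub>even\<^esub>(y)\<close>, which occur in neighbouring summands of \<open>S\<^sub>N\<close>. The sum telescopes
  (\<open>laguerre_skew_sum_telescopes\<close>) and a single product is left over, namely \<open>S\<^bsub>N,2\<^esub>\<close>.

  For the analysis, \<open>z\<^sup>\<alpha> K\<^sub>\<alpha>(z)\<close> is written as a function \<open>F\<^sub>\<alpha>(z\<^sup>2)\<close> given by an integral over the whole line; derivative, recurrence, continuity at
  \<open>0\<close> and the bounds all follow from elementary estimates of its integrand.
\<close>

section \<open>Integrals over the real line\<close>

lemma integral_real_line_FTC:
  fixes Q q :: "real \<Rightarrow> real"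
  assumes int: "integrable lborel q" and "finite S"
    and cont: "\<And>v. isCont Q v"
    and deriv: "\<And>v. v \<notin> S \<Longrightarrow> (Q has_real_derivative q v) (at v)"
    and bot: "(Q \<longlongrightarrow> a) at_bot" and top: "(Q \<longlongrightarrow> b) at_top"
  shows "(LBINT v. q v) = b - a"
proof -
  define I where "I n = {- real n..real n}" for n
  have "(\<lambda>n. LBINT v. indicator (I n) v * q v) \<longlonglongrightarrow> (LBINT v. q v)"
  proof (rule integral_dominated_convergence[where w = "\<lambda>v. \<bar>q v\<bar>"])
    show "AE v in lborel. (\<lambda>n. indicator (I n) v * q v) \<longlonglongrightarrow> q v"
    proof (rule AE_I2)
      fix v :: real
      obtain m :: nat where m: "\<bar>v\<bar> \<le> real m" using real_arch_simple by blast
      have "eventually (\<lambda>n. indicator (I n) v * q v = q v) sequentially"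
        using eventually_ge_at_top[of m]
      proof eventually_elim
        case (elim n)
        then have "v \<in> I n" using m by (auto simp: I_def)
        then show ?case by simp
      qed
      then show "(\<lambda>n. indicator (I n) v * q v) \<longlonglongrightarrow> q v" by (rule tendsto_eventually)
    qed
  qed (use int in \<open>auto simp: I_def indicator_def intro!: borel_measurable_times\<close>)
  moreover have "(LBINT v. indicator (I n) v * q v) = Q (real n) - Q (- real n)" for n
  proof -
    have "(q has_integral (Q (real n) - Q (- real n))) (I n)"
      unfolding I_def
      using deriv cont
      by (intro fundamental_theorem_of_calculus_strong[OF \<open>finite S\<close>])
        (auto simp: has_real_derivative_iff_has_vector_derivative[symmetric]
          intro: continuous_at_imp_continuous_on)
    moreover have "set_integrable lborel (I n) q"
      unfolding set_integrable_def using int by (intro integrable_mult_indicator) (auto simp: I_def)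
    ultimately show ?thesis
      using set_borel_integral_eq_integral(2)[of "I n" q]
      by (auto simp: set_lebesgue_integral_def dest: integral_unique)
  qed
  moreover have "(\<lambda>n. Q (real n) - Q (- real n)) \<longlonglongrightarrow> b - a"
    by (intro tendsto_diff filterlim_compose[OF top] filterlim_compose[OF bot]
        filterlim_real_sequentially filterlim_compose[OF filterlim_uminus_at_bot_at_top])
  ultimately show ?thesis by (simp add: LIMSEQ_unique)
qed

text \<open>
  The functions \<open>\<Phi>\<^sub>j\<close> are integrals against \<open>sgn (y - v)\<close>. Such an integral is explicit as soon as the
  integrand has a primitive \<open>G\<close> that vanishes at both ends: each half-line contributes \<open>G y\<close>.
  Reflecting \<open>G\<close> at the level \<open>G y\<close> beyond \<open>y\<close> turns this into one use of the fundamental theorem. The set \<open>S\<close>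
  will be \<open>{0}\<close>, where the weight is singular.
\<close>

lemma integral_sgn_times_derivative:
  fixes G g :: "real \<Rightarrow> real"
  assumes int: "integrable lborel g" and "finite S"
    and cont: "\<And>v. isCont G v"
    and deriv: "\<And>v. v \<notin> S \<Longrightarrow> (G has_real_derivative g v) (at v)"
    and bot: "(G \<longlongrightarrow> 0) at_bot" and top: "(G \<longlongrightarrow> 0) at_top"
  shows "(LBINT v. sgn (y - v) * g v) = 2 * G y"
proof -
  define Q where "Q v = (if v \<le> y then G v else 2 * G y - G v)" for v
  have "(LBINT v. sgn (y - v) * g v) = 2 * G y - 0"
  proof (rule integral_real_line_FTC[where Q = Q and S = "insert y S"])
    show "integrable lborel (\<lambda>v. sgn (y - v) * g v)"
      by (rule Bochner_Integration.integrable_bound[OF int])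
        (use int in \<open>auto simp: abs_mult sgn_real_def\<close>)
    show "finite (insert y S)" using \<open>finite S\<close> by simp
    show "isCont Q v" for v
    proof -
      have "continuous_on UNIV Q"
      proof -
        have "continuous_on ({..y} \<union> {y..}) Q" unfolding Q_def
          by (rule continuous_on_If) (auto intro!: continuous_intros continuous_at_imp_continuous_on cont)
        moreover have "{..y} \<union> {y..} = (UNIV::real set)" by auto
        ultimately show ?thesis by simp
      qed
      then show ?thesis by (simp add: continuous_on_eq_continuous_at)
    qed
    show "(Q has_real_derivative sgn (y - v) * g v) (at v)" if "v \<notin> insert y S" for v
    proof (cases "v < y")
      case True
      have "(G has_real_derivative sgn (y - v) * g v) (at v)"
        using deriv[of v] that True by simp
      moreover have "eventually (\<lambda>u. Q u = G u) (nhds v)"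
        using eventually_nhds_in_open[of "{..<y}" v] True
        by (auto elim!: eventually_mono simp: Q_def)
      ultimately show ?thesis by (subst DERIV_cong_ev[OF refl _ refl])
    next
      case False
      then have "y < v" using that by auto
      have "((\<lambda>u. 2 * G y - G u) has_real_derivative sgn (y - v) * g v) (at v)"
        using deriv[of v] that \<open>y < v\<close> by (auto intro!: derivative_eq_intros)
      moreover have "eventually (\<lambda>u. Q u = 2 * G y - G u) (nhds v)"
        using eventually_nhds_in_open[of "{y<..}" v] \<open>y < v\<close>
        by (auto elim!: eventually_mono simp: Q_def)
      ultimately show ?thesis by (subst DERIV_cong_ev[OF refl _ refl])
    qed
    have "eventually (\<lambda>v. Q v = G v) at_bot"
      using eventually_le_at_bot[of y] by eventually_elim (simp add: Q_def)
    then show "(Q \<longlongrightarrow> 0) at_bot" using bot by (subst tendsto_cong)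
    have "eventually (\<lambda>v. Q v = 2 * G y - G v) at_top"
      using eventually_gt_at_top[of y] by eventually_elim (simp add: Q_def)
    moreover have "((\<lambda>v. 2 * G y - G v) \<longlongrightarrow> 2 * G y - 0) at_top"
      by (intro tendsto_intros top)
    ultimately show "(Q \<longlongrightarrow> 2 * G y) at_top" by (subst tendsto_cong) simp_all
  qed
  then show ?thesis by simp
qed

lemma integrable_even_function:
  fixes f :: "real \<Rightarrow> real"
  assumes "set_integrable lborel {0<..} f" "\<And>v. f (- v) = f v"
  shows "integrable lborel f"
proof -
  have 1: "integrable lborel (\<lambda>v. indicator {0<..} v * f v)"
    using assms(1) by (simp add: set_integrable_def)
  have 2: "integrable lborel (\<lambda>v. indicator {0<..} (-v) * f v)"
    using lborel_integrable_real_affine[OF 1, of "-1" 0] assms(2) by simp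
  have "integrable lborel (\<lambda>v. indicator {0<..} v * f v + indicator {0<..} (-v) * f v)"
    using 1 2 by simp
  then show ?thesis
  proof (subst integrable_discrete_difference[of "{0}" lborel, where g = "\<lambda>v. indicator {0<..} v * f v + indicator {0<..} (-v) * f v"])
  qed (auto simp: indicator_def)
qed

text \<open>
  The majorant for the weight: it allows an integrable singularity at the origin.
\<close>

lemma integrable_abs_powr_exp:
  assumes "a > -1" "k > 0"
  shows "integrable lborel (\<lambda>v::real. \<bar>v\<bar> powr a * exp (- k * \<bar>v\<bar>))"
proof (rule integrable_even_function)
  let ?f = "\<lambda>v::real. \<bar>v\<bar> powr a * exp (- k * \<bar>v\<bar>)"
  have "set_integrable lebesgue {0<..} (\<lambda>t. complex_of_real t powr (of_real (a + 1) - 1) / of_real (exp (k * t)))"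
    using assms by (intro absolutely_integrable_Gamma_integral) auto
  then have "integrable lebesgue (\<lambda>t. norm (indicator {0<..} t *\<^sub>R (complex_of_real t powr (of_real (a + 1) - 1) / of_real (exp (k * t)))))"
    unfolding set_integrable_def by (rule integrable_norm)
  also have "(\<lambda>t. norm (indicator {0<..} t *\<^sub>R (complex_of_real t powr (of_real (a + 1) - 1) / of_real (exp (k * t)))))
    = (\<lambda>t. indicator {0<..} t *\<^sub>R ?f t)"
    by (auto simp: indicator_def fun_eq_iff norm_divide norm_powr_real_powr exp_minus field_simps)
  finally have "integrable (completion lborel) (\<lambda>t. indicator {0<..} t *\<^sub>R ?f t)" .
  then show "set_integrable lborel {0<..} ?f"
    unfolding set_integrable_def by (subst (asm) integrable_completion) auto
qed auto

section \<open>The Bessel function as an integral over the whole line\<close>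

lemma power_over_fact_le_exp:
  fixes x :: real
  assumes "x \<ge> 0"
  shows "x ^ m / fact m \<le> exp x"
proof -
  have "(\<Sum>k\<in>{m}. x ^ k / fact k) \<le> (\<Sum>k. x ^ k / fact k)"
    using assms summable_exp[of x] by (intro sum_le_suminf) (auto simp: divide_inverse mult.commute)
  then show ?thesis by (simp add: exp_def divide_inverse mult.commute)
qed

text \<open>
  A double exponential beats every exponential: compare \<open>exp (p e\<^sup>u)\<close> with the single Taylor term of a
  degree \<open>m \<ge> \<gamma> + k\<close>.
\<close>

lemma double_exp_decay:
  fixes p \<gamma> k :: real
  assumes "p > 0"
  obtains C where "C > 0" "\<And>u. u \<ge> 0 \<Longrightarrow> exp (- p * exp u + \<gamma> * u) \<le> C * exp (- k * u)"
proof -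
  define m where "m = nat \<lceil>\<gamma> + k\<rceil>"
  have m: "\<gamma> + k \<le> real m" unfolding m_def by linarith
  define C where "C = fact m / p ^ m"
  have "C > 0" using assms by (simp add: C_def)
  moreover have "exp (- p * exp u + \<gamma> * u) \<le> C * exp (- k * u)" if "u \<ge> 0" for u
  proof -
    have "(p * exp u) ^ m / fact m \<le> exp (p * exp u)"
      using assms by (intro power_over_fact_le_exp) auto
    then have "p ^ m * exp (real m * u) \<le> fact m * exp (p * exp u)"
      by (simp add: power_mult_distrib exp_of_nat_mult[symmetric] field_simps)
    then have "exp (real m * u) \<le> C * exp (p * exp u)"
      using assms by (simp add: C_def field_simps)
    moreover have "exp ((\<gamma> + k) * u) \<le> exp (real m * u)"
      using m that by (simp add: mult_right_mono)
    ultimately have "exp ((\<gamma> + k) * u) \<le> C * exp (p * exp u)" by linarith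
    then have "exp ((\<gamma> + k) * u) * (exp (- p * exp u) * exp (- k * u))
      \<le> C * exp (p * exp u) * (exp (- p * exp u) * exp (- k * u))"
      by (intro mult_right_mono) auto
    then show ?thesis
      by (simp add: exp_add[symmetric] mult.assoc algebra_simps)
  qed
  ultimately show ?thesis by (rule that)
qed

lemma two_sided_exp_bound:
  fixes p q \<alpha> :: real
  assumes "p > 0" "q \<ge> 0" "q > 0 \<or> \<alpha> > 0"
  obtains C k where "C > 0" "k > 0"
    "\<And>u. exp (- (p * exp u + q * exp (- u)) + \<alpha> * u) \<le> C * exp (- k * \<bar>u\<bar>)"
proof -
  define k where "k = (if q > 0 then 1 else \<alpha>)"
  have "k > 0" using assms by (auto simp: k_def)
  obtain C where C: "C > 0" "\<And>u. u \<ge> 0 \<Longrightarrow> exp (- p * exp u + \<alpha> * u) \<le> C * exp (- k * u)"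
    using double_exp_decay[OF \<open>p > 0\<close>] by metis
  obtain D where D: "D > 0" "\<And>u. u \<ge> 0 \<Longrightarrow> exp (- q * exp u - \<alpha> * u) \<le> D * exp (- k * u)"
  proof (cases "q > 0")
    case True
    show ?thesis using double_exp_decay[OF True, of "- \<alpha>" k] that by auto
  next
    case False
    then show ?thesis using assms that[of 1] by (auto simp: k_def)
  qed
  have "exp (- (p * exp u + q * exp (- u)) + \<alpha> * u) \<le> (C + D) * exp (- k * \<bar>u\<bar>)" for u
  proof (cases "u \<ge> 0")
    case True
    have "exp (- (p * exp u + q * exp (- u)) + \<alpha> * u) \<le> exp (- p * exp u + \<alpha> * u)"
      using \<open>q \<ge> 0\<close> by simp
    also have "\<dots> \<le> C * exp (- k * u)" using C(2) True .
    also have "\<dots> \<le> (C + D) * exp (- k * u)" using D(1) by simp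
    finally show ?thesis using True by simp
  next
    case False
    have "exp (- (p * exp u + q * exp (- u)) + \<alpha> * u) \<le> exp (- q * exp (- u) - \<alpha> * (- u))"
      using \<open>p > 0\<close> by simp
    also have "\<dots> \<le> D * exp (- k * (- u))" using D(2)[of "- u"] False by simp
    also have "\<dots> \<le> (C + D) * exp (- k * (- u))" using C(1) by simp
    finally show ?thesis using False by simp
  qed
  with C(1) D(1) \<open>k > 0\<close> show ?thesis by (intro that[of "C + D" k]) auto
qed

lemma integrable_exp_abs:
  assumes "k > 0"
  shows "integrable lborel (\<lambda>v::real. exp (- k * \<bar>v\<bar>))"
proof (subst integrable_discrete_difference[of "{0}" lborel, where g = "\<lambda>v. \<bar>v\<bar> powr 0 * exp (- k * \<bar>v\<bar>)"])
  show "integrable lborel (\<lambda>v::real. \<bar>v\<bar> powr 0 * exp (- k * \<bar>v\<bar>))"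
    using integrable_abs_powr_exp[of 0 k] assms by simp
qed auto

lemma integrable_two_sided_exp:
  fixes p q \<alpha> :: real
  assumes "p > 0" "q \<ge> 0" "q > 0 \<or> \<alpha> > 0"
  shows "integrable lborel (\<lambda>u. exp (- (p * exp u + q * exp (- u)) + \<alpha> * u))"
proof -
  obtain C k where C: "C > 0" "k > 0"
    "\<And>u. exp (- (p * exp u + q * exp (- u)) + \<alpha> * u) \<le> C * exp (- k * \<bar>u\<bar>)"
    using two_sided_exp_bound[OF assms] by metis
  show ?thesis
    by (rule Bochner_Integration.integrable_bound[where f = "\<lambda>u. C * exp (- k * \<bar>u\<bar>)"])
      (use C integrable_exp_abs[of k] in auto)
qed

text \<open>
  The substitution \<open>u = t + ln z\<close> in \<open>2 K\<^sub>\<alpha>(z) = \<integral> e\<^bsup>-z cosh t + \<alpha> t\<^esup> dt\<close> gives \<open>z\<^sup>\<alpha> K\<^sub>\<alpha>(z) = F\<^sub>\<alpha>(z\<^sup>2)\<close> with the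
  function \<open>F\<^sub>\<alpha>\<close> (\<open>bessel_F\<close>) below. In terms of \<open>F\<^sub>\<alpha>\<close> the factor \<open>|y|\<^sup>\<alpha> K\<^sub>\<alpha>(c |y|)\<close> depends on \<open>y\<^sup>2\<close> only, so that
  both signs of \<open>y\<close> are treated at once, and for \<open>\<alpha> > 0\<close> the function extends continuously to \<open>0\<close>.
\<close>

definition bessel_kernel :: "real \<Rightarrow> real \<Rightarrow> real \<Rightarrow> real" where
  "bessel_kernel \<alpha> s u = exp (- (exp u + s * exp (- u)) / 2 + \<alpha> * u)"

definition bessel_F :: "real \<Rightarrow> real \<Rightarrow> real" where
  "bessel_F \<alpha> s = (LBINT u. bessel_kernel \<alpha> s u) / 2"

lemma bessel_kernel_pos: "bessel_kernel \<alpha> s u > 0"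
  by (simp add: bessel_kernel_def)

lemma bessel_kernel_measurable [measurable]: "bessel_kernel \<alpha> s \<in> borel_measurable borel"
  unfolding bessel_kernel_def by measurable

lemma bessel_kernel_bound:
  assumes "s \<ge> 0" "s > 0 \<or> \<alpha> > 0"
  obtains C k where "C > 0" "k > 0" "\<And>u. bessel_kernel \<alpha> s u \<le> C * exp (- k * \<bar>u\<bar>)"
proof -
  have "bessel_kernel \<alpha> s u = exp (- (1/2 * exp u + s/2 * exp (- u)) + \<alpha> * u)" for u
    by (simp add: bessel_kernel_def field_simps)
  then show ?thesis using two_sided_exp_bound[of "1/2" "s/2" \<alpha>] assms that by auto
qed

lemma integrable_bessel_kernel:
  assumes "s \<ge> 0" "s > 0 \<or> \<alpha> > 0"
  shows "integrable lborel (bessel_kernel \<alpha> s)"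
proof -
  have "bessel_kernel \<alpha> s = (\<lambda>u. exp (- (1/2 * exp u + s/2 * exp (- u)) + \<alpha> * u))"
    by (simp add: bessel_kernel_def field_simps fun_eq_iff)
  then show ?thesis using integrable_two_sided_exp[of "1/2" "s/2" \<alpha>] assms by simp
qed

lemma bessel_F_nonneg: "bessel_F \<alpha> s \<ge> 0"
  unfolding bessel_F_def by (intro divide_nonneg_pos integral_nonneg_AE AE_I2 less_imp_le bessel_kernel_pos) simp

text \<open>
  The integrand decreases in \<open>s\<close>, so its value at the left end \<open>r\<close> is a majorant. The case \<open>r = 0\<close> needs
  \<open>\<alpha> > 0\<close> and gives the continuity of \<open>|y|\<^sup>\<alpha> K\<^sub>\<alpha>(|y|)\<close> at the origin.
\<close>

lemma continuous_on_bessel_F: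
  assumes "r \<ge> 0" "r > 0 \<or> \<alpha> > 0"
  shows "continuous_on {r..} (bessel_F \<alpha>)"
  unfolding continuous_on_sequentially
proof (intro allI ballI impI, elim conjE)
  fix X :: "nat \<Rightarrow> real" and s
  assume X: "\<forall>n. X n \<in> {r..}" "X \<longlonglongrightarrow> s"
  have "(\<lambda>n. LBINT u. bessel_kernel \<alpha> (X n) u) \<longlonglongrightarrow> (LBINT u. bessel_kernel \<alpha> s u)"
  proof (rule integral_dominated_convergence[where w = "bessel_kernel \<alpha> r"])
    show "integrable lborel (bessel_kernel \<alpha> r)" by (rule integrable_bessel_kernel) fact+
    show "AE u in lborel. (\<lambda>n. bessel_kernel \<alpha> (X n) u) \<longlonglongrightarrow> bessel_kernel \<alpha> s u"
      unfolding bessel_kernel_def using X(2) by (intro AE_I2 tendsto_intros) auto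
    show "AE u in lborel. norm (bessel_kernel \<alpha> (X n) u) \<le> bessel_kernel \<alpha> r u" for n
      using X(1) by (intro AE_I2) (simp add: bessel_kernel_def mult_right_mono)
  qed measurable
  then show "(bessel_F \<alpha> \<circ> X) \<longlonglongrightarrow> bessel_F \<alpha> s"
    unfolding bessel_F_def o_def by (intro tendsto_divide) auto
qed

lemma isCont_bessel_F:
  assumes "s > 0"
  shows "isCont (bessel_F \<alpha>) s"
proof -
  have "continuous_on {s/2<..} (bessel_F \<alpha>)"
    using continuous_on_bessel_F[of "s/2" \<alpha>] assms by (auto elim: continuous_on_subset)
  then show ?thesis using assms by (simp add: continuous_on_eq_continuous_at)
qed

text \<open>
  The integrand is convex in \<open>s\<close>, with derivative \<open>- 1/2\<close> times the integrand of order \<open>\<alpha> - 1\<close>; hence it lies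
  above its tangents. Used at \<open>s\<close> and at \<open>t\<close>, this squeezes the difference quotient between two values of
  \<open>- F\<^bsub>\<alpha>-1\<^esub> / 2\<close>, and continuity gives the derivative.
\<close>

lemma bessel_F_tangent:
  assumes "s > 0" "t > 0"
  shows "bessel_F \<alpha> t - bessel_F \<alpha> s \<ge> - (t - s) / 2 * bessel_F (\<alpha> - 1) s"
proof -
  have pw: "bessel_kernel \<alpha> t u \<ge> bessel_kernel \<alpha> s u - (t - s) / 2 * bessel_kernel (\<alpha> - 1) s u" for u
  proof -
    have "bessel_kernel \<alpha> s u * (1 + (- (t - s) / 2 * exp (- u)))
      \<le> bessel_kernel \<alpha> s u * exp (- (t - s) / 2 * exp (- u))"
      by (intro mult_left_mono exp_ge_add_one_self less_imp_le bessel_kernel_pos)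
    also have "\<dots> = bessel_kernel \<alpha> t u"
      by (simp add: bessel_kernel_def exp_add[symmetric] field_simps)
    also have "bessel_kernel \<alpha> s u * (1 + (- (t - s) / 2 * exp (- u)))
      = bessel_kernel \<alpha> s u - (t - s) / 2 * (bessel_kernel \<alpha> s u * exp (- u))"
      by (simp add: algebra_simps diff_divide_distrib)
    also have "bessel_kernel \<alpha> s u * exp (- u) = bessel_kernel (\<alpha> - 1) s u"
      by (simp add: bessel_kernel_def exp_add[symmetric] algebra_simps)
    finally show ?thesis .
  qed
  note int = integrable_bessel_kernel[of _ \<alpha>] integrable_bessel_kernel[of _ "\<alpha> - 1"]
  have "(LBINT u. bessel_kernel \<alpha> s u - (t - s) / 2 * bessel_kernel (\<alpha> - 1) s u)
    \<le> (LBINT u. bessel_kernel \<alpha> t u)"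
    using assms int by (intro integral_mono pw) auto
  also have "(LBINT u. bessel_kernel \<alpha> s u - (t - s) / 2 * bessel_kernel (\<alpha> - 1) s u)
    = (LBINT u. bessel_kernel \<alpha> s u) - (t - s) / 2 * (LBINT u. bessel_kernel (\<alpha> - 1) s u)"
    using assms int by (subst Bochner_Integration.integral_diff) auto
  finally show ?thesis by (simp add: bessel_F_def field_simps)
qed

lemma DERIV_bessel_F:
  assumes "s > 0"
  shows "(bessel_F \<alpha> has_real_derivative - bessel_F (\<alpha> - 1) s / 2) (at s)"
proof -
  have "eventually (\<lambda>t. norm ((bessel_F \<alpha> t - bessel_F \<alpha> s) / (t - s) - (- bessel_F (\<alpha> - 1) s / 2))
      \<le> \<bar>bessel_F (\<alpha> - 1) t - bessel_F (\<alpha> - 1) s\<bar> / 2) (at s)"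
  proof -
    have "eventually (\<lambda>t. t \<in> {0<..} - {s}) (at s)"
      using assms by (intro eventually_at_in_open) auto
    then show ?thesis
    proof eventually_elim
      case (elim t)
      let ?D = "bessel_F \<alpha> t - bessel_F \<alpha> s" and ?f = "bessel_F (\<alpha> - 1) s" and ?g = "bessel_F (\<alpha> - 1) t"
      have 1: "?D \<ge> - (t - s) / 2 * ?f" and 2: "- ?D \<ge> - (s - t) / 2 * ?g"
        using bessel_F_tangent[of s t \<alpha>] bessel_F_tangent[of t s \<alpha>] assms elim by auto
      have near: "norm (q - (- ?f / 2)) \<le> \<bar>?g - ?f\<bar> / 2"
        if "q \<ge> - ?f / 2 \<and> q \<le> - ?g / 2 \<or> q \<le> - ?f / 2 \<and> q \<ge> - ?g / 2" for q
        using that by (auto simp: abs_if field_simps)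
      show ?case
      proof (cases "t > s")
        case True
        then have "- ?f / 2 \<le> ?D / (t - s) \<and> ?D / (t - s) \<le> - ?g / 2"
          using 1 2 by (auto simp: field_simps)
        then show ?thesis by (intro near) blast
      next
        case False
        then have "t < s" using elim by auto
        then have "?D / (t - s) \<le> - ?f / 2 \<and> - ?g / 2 \<le> ?D / (t - s)"
          using 1 2 by (auto simp: field_simps)
        then show ?thesis by (intro near) blast
      qed
    qed
  qed
  moreover have "((\<lambda>t. \<bar>bessel_F (\<alpha> - 1) t - bessel_F (\<alpha> - 1) s\<bar> / 2) \<longlongrightarrow> 0) (at s)"
    using isCont_bessel_F[OF assms, of "\<alpha> - 1"] unfolding isCont_def
    by (auto intro!: tendsto_eq_intros)
  ultimately have "((\<lambda>t. (bessel_F \<alpha> t - bessel_F \<alpha> s) / (t - s) - (- bessel_F (\<alpha> - 1) s / 2)) \<longlongrightarrow> 0) (at s)"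
    by (rule Lim_null_comparison)
  then show ?thesis unfolding has_field_derivative_iff by (rule LIM_zero_cancel)
qed

lemma exp_neg_mult_abs_tendsto_0:
  fixes k C :: real
  assumes "k > 0"
  shows "((\<lambda>u. C * exp (- k * \<bar>u\<bar>)) \<longlongrightarrow> 0) at_top" "((\<lambda>u. C * exp (- k * \<bar>u\<bar>)) \<longlongrightarrow> 0) at_bot"
proof -
  have *: "((\<lambda>u. C * exp (- k * \<bar>u\<bar>)) \<longlongrightarrow> C * 0) F" if "filterlim (\<lambda>u::real. \<bar>u\<bar>) at_top F" for F
    using assms that
    by (intro tendsto_intros filterlim_compose[OF exp_at_bot]
        filterlim_tendsto_neg_mult_at_bot[OF tendsto_const]) auto
  show "((\<lambda>u. C * exp (- k * \<bar>u\<bar>)) \<longlongrightarrow> 0) at_top" "((\<lambda>u. C * exp (- k * \<bar>u\<bar>)) \<longlongrightarrow> 0) at_bot"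
    using *[OF filterlim_abs_real]  *[of at_bot] filterlim_at_infinity_imp_norm_at_top[OF filterlim_mono[OF filterlim_ident at_bot_le_at_infinity order_refl]]
    by auto
qed

text \<open>
  Integrating \<open>d/du\<close> of the integrand over the line gives \<open>0\<close>, since it decays at both ends. For \<open>K\<close> this is the recurrence
  \<open>K\<^bsub>\<alpha>+1\<^esub>(z) = K\<^bsub>\<alpha>-1\<^esub>(z) + (2 \<alpha> / z) K\<^sub>\<alpha>(z)\<close>.
\<close>

lemma bessel_F_recurrence:
  assumes "s > 0"
  shows "bessel_F (\<alpha> + 1) s = s * bessel_F (\<alpha> - 1) s + 2 * \<alpha> * bessel_F \<alpha> s"
proof -
  obtain C k where C: "C > 0" "k > 0" "\<And>u. bessel_kernel \<alpha> s u \<le> C * exp (- k * \<bar>u\<bar>)"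
    using bessel_kernel_bound[of s \<alpha>] assms by auto
  let ?q = "\<lambda>u. - (bessel_kernel (\<alpha> + 1) s u / 2) + s / 2 * bessel_kernel (\<alpha> - 1) s u + \<alpha> * bessel_kernel \<alpha> s u"
  note int = integrable_bessel_kernel[of s "\<alpha> + 1"] integrable_bessel_kernel[of s "\<alpha> - 1"]
    integrable_bessel_kernel[of s \<alpha>]
  have lim: "(bessel_kernel \<alpha> s \<longlongrightarrow> 0) F" if "((\<lambda>u. C * exp (- k * \<bar>u\<bar>)) \<longlongrightarrow> 0) F" for F
    by (rule Lim_null_comparison[OF _ that])
      (use C(3) bessel_kernel_pos[of \<alpha> s] in \<open>auto simp: abs_of_pos\<close>)
  have "(LBINT u. ?q u) = 0 - 0"
  proof (rule integral_real_line_FTC[where Q = "bessel_kernel \<alpha> s" and S = "{}"])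
    show "integrable lborel ?q" using int assms by auto
    show "(bessel_kernel \<alpha> s has_real_derivative ?q u) (at u)" for u
      unfolding bessel_kernel_def
      by (auto intro!: derivative_eq_intros simp: exp_add exp_diff exp_minus algebra_simps) (simp add: field_simps)
    then show "isCont (bessel_kernel \<alpha> s) u" for u by (blast intro: DERIV_isCont)
    show "(bessel_kernel \<alpha> s \<longlongrightarrow> 0) at_bot" "(bessel_kernel \<alpha> s \<longlongrightarrow> 0) at_top"
      using exp_neg_mult_abs_tendsto_0[OF C(2)] by (auto intro!: lim)
  qed simp_all
  also have "(LBINT u. ?q u) = - bessel_F (\<alpha> + 1) s + s * bessel_F (\<alpha> - 1) s + 2 * \<alpha> * bessel_F \<alpha> s"
    using int assms by (simp add: bessel_F_def)
  finally show ?thesis by simp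
qed

text \<open>
  One bound that controls both ends. With \<open>q = s e\<^bsup>-u\<^esup>\<close>, split the exponent \<open>(e\<^sup>u + q)/2\<close> into the fractions
  \<open>1 - \<epsilon>\<close> and \<open>\<epsilon>\<close>. By the arithmetic-geometric mean inequality \<open>(e\<^sup>u + q)/2 \<ge> \<surd>s\<close>, so the first fraction gives the exponential decay. From the
  second, \<open>e\<^bsup>-\<epsilon>q/2\<^esup> \<le> (\<epsilon>q/2)\<^bsup>-\<beta>\<^esup>\<close> trades a singularity \<open>s\<^bsup>-\<beta>\<^esup>\<close> for a gain \<open>e\<^bsup>\<beta> u\<^esup>\<close>, which makes the remaining integral converge at
  \<open>- \<infinity>\<close> although \<open>\<alpha>\<close> may be negative.
\<close>

lemma bessel_F_bound:
  assumes "0 \<le> \<beta>" "\<beta> \<le> 1" "\<alpha> + \<beta> > 0" "0 < \<epsilon>" "\<epsilon> < 1"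
  obtains C where "C \<ge> 0" "\<And>s. s > 0 \<Longrightarrow> bessel_F \<alpha> s \<le> C * s powr (- \<beta>) * exp (- (1 - \<epsilon>) * sqrt s)"
proof -
  define J where "J u = exp (- (\<epsilon> / 2 * exp u + 0 * exp (- u)) + (\<alpha> + \<beta>) * u)" for u
  have intJ: "integrable lborel J"
    unfolding J_def using assms by (intro integrable_two_sided_exp) auto
  define C where "C = (\<epsilon> / 2) powr (- \<beta>) * (LBINT u. J u) / 2"
  have "bessel_F \<alpha> s \<le> C * s powr (- \<beta>) * exp (- (1 - \<epsilon>) * sqrt s)" if "s > 0" for s
  proof -
    let ?c = "(\<epsilon> / 2) powr (- \<beta>) * s powr (- \<beta>) * exp (- (1 - \<epsilon>) * sqrt s)"
    have "bessel_kernel \<alpha> s u \<le> ?c * J u" for u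
    proof -
      define r where "r = \<epsilon> / 2 * (s * exp (- u))"
      have "r > 0" using assms that by (simp add: r_def)
      have "r powr \<beta> \<le> exp r"
      proof (cases "r \<le> 1")
        case True
        then have "r powr \<beta> \<le> 1" using assms \<open>r > 0\<close> by (simp add: powr_le1)
        also have "1 \<le> exp r" using \<open>r > 0\<close> by simp
        finally show ?thesis .
      next
        case False
        then have "r powr \<beta> \<le> r powr 1" using assms by (intro powr_mono) auto
        also have "\<dots> \<le> exp r" using False exp_ge_add_one_self[of r] by (simp del: exp_ge_add_one_self)
        finally show ?thesis .
      qed
      then have "exp (- r) \<le> r powr (- \<beta>)"
        using \<open>r > 0\<close> by (simp add: exp_minus powr_minus field_simps)
      also have "\<dots> = (\<epsilon> / 2) powr (- \<beta>) * s powr (- \<beta>) * exp (\<beta> * u)"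
        using assms that by (simp add: r_def powr_mult exp_powr_real powr_divide field_simps)
      finally have r: "exp (- r) \<le> (\<epsilon> / 2) powr (- \<beta>) * s powr (- \<beta>) * exp (\<beta> * u)" .
      have "0 \<le> (exp (u / 2) - sqrt s * exp (- u / 2))\<^sup>2" by simp
      also have "\<dots> = exp u + s * exp (- u) - 2 * sqrt s"
        using that by (simp add: power2_diff power_mult_distrib field_simps exp_minus flip: exp_double exp_add power2_eq_square)
      finally have amgm: "sqrt s \<le> (exp u + s * exp (- u)) / 2" by simp
      have "bessel_kernel \<alpha> s u = exp (- (1 - \<epsilon>) * ((exp u + s * exp (- u)) / 2)) * (exp (- r) * exp (- (\<epsilon> / 2 * exp u) + \<alpha> * u))"
        by (simp add: bessel_kernel_def r_def exp_add[symmetric] field_simps)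
      also have "\<dots> \<le> exp (- (1 - \<epsilon>) * sqrt s) * (((\<epsilon> / 2) powr (- \<beta>) * s powr (- \<beta>) * exp (\<beta> * u)) * exp (- (\<epsilon> / 2 * exp u) + \<alpha> * u))"
        using r amgm assms by (intro mult_mono) auto
      also have "\<dots> = ?c * J u"
        by (simp add: J_def exp_add exp_diff exp_minus algebra_simps)
      finally show ?thesis .
    qed
    then have "(LBINT u. bessel_kernel \<alpha> s u) \<le> (LBINT u. ?c * J u)"
      using intJ that by (intro integral_mono integrable_bessel_kernel) auto
    then show ?thesis by (simp add: bessel_F_def C_def mult_ac)
  qed
  moreover have "C \<ge> 0" unfolding C_def J_def by (intro mult_nonneg_nonneg divide_nonneg_pos integral_nonneg_AE) auto
  ultimately show ?thesis using that by blast
qed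

section \<open>Laguerre polynomials\<close>

text \<open>
  Coefficients that are defined (as \<open>0\<close>) beyond the degree and for negative degree let every
  identity below be checked coefficient by coefficient, including the boundary cases.
\<close>

definition laguerre_coeff :: "real \<Rightarrow> int \<Rightarrow> nat \<Rightarrow> real" where
  "laguerre_coeff \<nu> j k =
     (if int k \<le> j
      then (-1) ^ k * Gamma (of_int j + \<nu> + 1) / (fact k * fact (nat j - k) * Gamma (\<nu> + of_nat k + 1))
      else 0)"

definition laguerre_poly :: "real \<Rightarrow> int \<Rightarrow> real poly" where
  "laguerre_poly \<nu> j = (\<Sum>k\<le>nat j. monom (laguerre_coeff \<nu> j k) k)"

lemma coeff_laguerre_poly [simp]: "coeff (laguerre_poly \<nu> j) k = laguerre_coeff \<nu> j k"
  by (auto simp: laguerre_poly_def coeff_sum laguerre_coeff_def)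

lemma poly_laguerre_poly: "poly (laguerre_poly \<nu> j) z = laguerre \<nu> j z"
proof (cases "j < 0")
  case True
  then have "laguerre_poly \<nu> j = 0" by (intro poly_eqI) (simp add: laguerre_coeff_def)
  then show ?thesis using True by (simp add: laguerre_def)
next
  case False
  have "poly (laguerre_poly \<nu> j) z = (\<Sum>k\<le>nat j. laguerre_coeff \<nu> j k * z ^ k)"
    by (simp add: laguerre_poly_def poly_sum poly_monom)
  also have "\<dots> = laguerre \<nu> j z"
    using False unfolding laguerre_def
    by (auto simp: atLeast0AtMost laguerre_coeff_def power_minus[of z] le_nat_iff mult_ac intro!: sum.cong)
  finally show ?thesis .
qed

lemma laguerre_poly_minus_one [simp]: "laguerre_poly \<nu> (- 1) = 0"
  by (intro poly_eqI) (simp add: laguerre_coeff_def)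

lemma Gamma_real_plus1:
  fixes x :: real
  assumes "x > 0"
  shows "Gamma (x + 1) = x * Gamma x"
proof -
  have "x \<notin> \<int>\<^sub>\<le>\<^sub>0" using assms by (metis nonpos_Ints_nonpos not_le)
  then show ?thesis by (rule Gamma_plus1)
qed

lemma laguerre_coeff_degree_step:
  assumes "\<nu> > -1" "j \<ge> 0"
  shows "(of_int j - real k) * laguerre_coeff \<nu> j k = (of_int j + \<nu>) * laguerre_coeff \<nu> (j - 1) k"
proof (cases "int k \<le> j - 1")
  case True
  then have m: "j = int (Suc (k + nat (j - 1 - int k)))" by simp
  define m where "m = nat (j - 1 - int k)"
  note m = m[folded m_def]
  have "real_of_int j + \<nu> > 0" using assms m by simp
  then have "Gamma (of_int j + \<nu> + 1) = (of_int j + \<nu>) * Gamma (of_int (j - 1) + \<nu> + 1)"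
    using Gamma_real_plus1[of "of_int j + \<nu>"] by simp
  moreover have "Gamma (\<nu> + real k + 1) \<noteq> 0"
    using assms by (intro less_imp_neq[OF Gamma_real_pos, symmetric]) simp
  moreover have "nat j - k = Suc m" "nat (j - 1) - k = m" "real_of_int j = real k + real m + 1"
    using m by auto
  moreover have "int k \<le> j" using True by simp
  ultimately show ?thesis using True unfolding laguerre_coeff_def
    by (simp only: if_True) (simp add: divide_simps)
next
  case False
  then show ?thesis by (auto simp: laguerre_coeff_def)
qed

lemma laguerre_coeff_index_step:
  assumes "\<nu> > -1" "j \<ge> 0"
  shows "real (Suc k) * (\<nu> + real k + 1) * laguerre_coeff \<nu> j (Suc k)
    = - (of_int j - real k) * laguerre_coeff \<nu> j k"
proof (cases "int k \<le> j - 1")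
  case True
  then have m: "j = int (Suc (k + nat (j - 1 - int k)))" by simp
  define m where "m = nat (j - 1 - int k)"
  note m = m[folded m_def]
  have "\<nu> + real k + 1 > 0" using assms by simp
  then have "Gamma (\<nu> + real k + 1 + 1) = (\<nu> + real k + 1) * Gamma (\<nu> + real k + 1)"
    "Gamma (\<nu> + real k + 1) \<noteq> 0"
    using Gamma_real_plus1[of "\<nu> + real k + 1"]
    by (auto simp: less_imp_neq[OF Gamma_real_pos, symmetric])
  moreover have "\<nu> + real (Suc k) + 1 = \<nu> + real k + 1 + 1" by simp
  moreover have "nat j - k = Suc m" "nat j - Suc k = m" "real_of_int j = real k + real m + 1"
    using m by auto
  ultimately show ?thesis using True \<open>\<nu> + real k + 1 > 0\<close> unfolding laguerre_coeff_def
    by (simp add: divide_simps) (simp add: algebra_simps)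
next
  case False
  then show ?thesis by (auto simp: laguerre_coeff_def)
qed

text \<open>
  The operator \<open>z d/dz\<close> multiplies the \<open>k\<close>-th coefficient by \<open>k\<close>, so the claim is \<open>laguerre_coeff_degree_step\<close>. This
  identity and \<open>L\<^bsub>j-1\<^esub>' = L\<^sub>j' + L\<^bsub>j-1\<^esub>\<close> together imply the differential equation and the three-term recurrence.
\<close>

lemma laguerre_poly_euler:
  assumes "\<nu> > -1" "j \<ge> 0"
  shows "[:0, 1:] * pderiv (laguerre_poly \<nu> j)
    = smult (of_int j) (laguerre_poly \<nu> j) - smult (of_int j + \<nu>) (laguerre_poly \<nu> (j - 1))"
proof (rule poly_eqI)
  fix k
  show "coeff ([:0, 1:] * pderiv (laguerre_poly \<nu> j)) k
    = coeff (smult (of_int j) (laguerre_poly \<nu> j) - smult (of_int j + \<nu>) (laguerre_poly \<nu> (j - 1))) k"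
    using laguerre_coeff_degree_step[OF assms, of k]
    by (cases k) (simp_all add: coeff_pderiv algebra_simps)
qed

lemma laguerre_poly_pderiv_step:
  assumes "\<nu> > -1" "j \<ge> 0"
  shows "pderiv (laguerre_poly \<nu> (j - 1)) = pderiv (laguerre_poly \<nu> j) + laguerre_poly \<nu> (j - 1)"
proof (cases "j = 0")
  case True
  have "pderiv (laguerre_poly \<nu> 0) = 0"
    by (intro poly_eqI) (simp add: coeff_pderiv laguerre_coeff_def)
  then show ?thesis using True by simp
next
  case False
  show ?thesis
  proof (rule poly_eqI)
    fix k
    let ?a = "laguerre_coeff \<nu>"
    have pos: "\<nu> + real k + 1 > 0" using assms by simp
    have "(\<nu> + real k + 1) * (real (Suc k) * ?a (j - 1) (Suc k))
      = - (of_int (j - 1) - real k) * ?a (j - 1) k"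
      using laguerre_coeff_index_step[of \<nu> "j - 1" k] assms False by (simp add: mult_ac)
    also have "\<dots> = - ((of_int j + \<nu>) * ?a (j - 1) k) + (\<nu> + real k + 1) * ?a (j - 1) k"
      by (simp add: algebra_simps)
    also have "\<dots> = (\<nu> + real k + 1) * (real (Suc k) * ?a j (Suc k) + ?a (j - 1) k)"
      using laguerre_coeff_index_step[OF assms, of k] laguerre_coeff_degree_step[OF assms, of k]
      by (simp add: algebra_simps)
    finally have "real (Suc k) * ?a (j - 1) (Suc k) = real (Suc k) * ?a j (Suc k) + ?a (j - 1) k"
      using pos by (simp only: mult_cancel_left) auto
    then show "coeff (pderiv (laguerre_poly \<nu> (j - 1))) k
      = coeff (pderiv (laguerre_poly \<nu> j) + laguerre_poly \<nu> (j - 1)) k"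
      by (simp only: coeff_pderiv coeff_add coeff_laguerre_poly)
  qed
qed

text \<open>
  The second-order operator that comes from differentiating the primitive of the weighted polynomials. The
  Laguerre equation removes \<open>L''\<close>; then \<open>z L'\<close> and \<open>z L\<close> are expanded in \<open>L\<^bsub>j-1\<^esub>\<close>, \<open>L\<^sub>j\<close>, \<open>L\<^bsub>j+1\<^esub>\<close>, and the
  coefficient of \<open>L\<^sub>j\<close> cancels. This cancellation is what leaves exactly the combination in the odd
  polynomials \<open>p\<^bsub>2j+1\<^esub>\<close>.
\<close>

lemma laguerre_operator:
  fixes \<tau> z :: real
  assumes "\<nu> > -1" "j \<ge> 0"
  defines "L \<equiv> poly (laguerre_poly \<nu> j)" and "L' \<equiv> poly (pderiv (laguerre_poly \<nu> j))"
    and "L'' \<equiv> poly (pderiv (pderiv (laguerre_poly \<nu> j)))"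
  shows "(1 - \<tau>\<^sup>2) * z * L'' z + ((1 - \<tau>\<^sup>2) * (1 + \<nu>) + 2 * \<tau>\<^sup>2 * z) * L' z + \<tau>\<^sup>2 * (1 + \<nu> - z) * L z
    = \<tau>\<^sup>2 * (of_int j + 1) * laguerre \<nu> (j + 1) z - (of_int j + \<nu>) * laguerre \<nu> (j - 1) z"
proof -
  define Lm Lm' Lp Lp' where "Lm = poly (laguerre_poly \<nu> (j - 1)) z"
    and "Lm' = poly (pderiv (laguerre_poly \<nu> (j - 1))) z"
    and "Lp = poly (laguerre_poly \<nu> (j + 1)) z"
    and "Lp' = poly (pderiv (laguerre_poly \<nu> (j + 1))) z"
  note defs = L_def L'_def L''_def Lm_def Lm'_def Lp_def Lp'_def
  have euler: "z * L' z = of_int j * L z - (of_int j + \<nu>) * Lm"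
    using arg_cong[OF laguerre_poly_euler[OF assms(1,2)], of "\<lambda>p. poly p z"] by (simp add: defs)
  have euler': "L' z + z * L'' z = of_int j * L' z - (of_int j + \<nu>) * Lm'"
    using arg_cong[OF laguerre_poly_euler[OF assms(1,2)], of "\<lambda>p. poly (pderiv p) z"]
    by (simp add: defs pderiv_mult pderiv_diff pderiv_smult pderiv_pCons)
  have euler_p: "z * Lp' = (of_int j + 1) * Lp - (of_int j + 1 + \<nu>) * L z"
    using arg_cong[OF laguerre_poly_euler[of \<nu> "j + 1"], of "\<lambda>p. poly p z"] assms(1,2)
    by (simp add: defs)
  have step: "Lm' = L' z + Lm"
    using arg_cong[OF laguerre_poly_pderiv_step[OF assms(1,2)], of "\<lambda>p. poly p z"] by (simp add: defs)
  have step_p: "L' z = Lp' + L z"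
    using arg_cong[OF laguerre_poly_pderiv_step[of \<nu> "j + 1"], of "\<lambda>p. poly p z"] assms(1,2)
    by (simp add: defs)
  have ode: "z * L'' z = (z - \<nu> - 1) * L' z - of_int j * L z"
    using euler euler' step by (simp add: algebra_simps)
  have "z * L z = z * L' z - z * Lp'" using step_p by (simp add: algebra_simps)
  then have rec: "z * L z = (2 * of_int j + 1 + \<nu>) * L z - (of_int j + 1) * Lp - (of_int j + \<nu>) * Lm"
    using euler euler_p by (simp add: algebra_simps)
  have "(1 - \<tau>\<^sup>2) * z * L'' z + ((1 - \<tau>\<^sup>2) * (1 + \<nu>) + 2 * \<tau>\<^sup>2 * z) * L' z + \<tau>\<^sup>2 * (1 + \<nu> - z) * L z
    = (1 - \<tau>\<^sup>2) * (z * L'' z) + (1 - \<tau>\<^sup>2) * (1 + \<nu>) * L' z + 2 * \<tau>\<^sup>2 * (z * L' z)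
      + \<tau>\<^sup>2 * (1 + \<nu>) * L z - \<tau>\<^sup>2 * (z * L z)"
    by (simp add: algebra_simps)
  also have "\<dots> = (1 + \<tau>\<^sup>2) * (z * L' z) - (1 - \<tau>\<^sup>2) * of_int j * L z + \<tau>\<^sup>2 * (1 + \<nu>) * L z - \<tau>\<^sup>2 * (z * L z)"
    unfolding ode by (simp add: algebra_simps)
  also have "\<dots> = \<tau>\<^sup>2 * (of_int j + 1) * Lp - (of_int j + \<nu>) * Lm"
    unfolding euler rec by (simp add: algebra_simps)
  finally show ?thesis by (simp add: Lp_def Lm_def poly_laguerre_poly)
qed

section \<open>Bessel functions and exponential majorants\<close>

lemma integral_even_function:
  fixes f :: "real \<Rightarrow> real"
  assumes int: "integrable lborel f" and even: "\<And>v. f (- v) = f v"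
  shows "(LBINT v. f v) = 2 * (LBINT v:{0..}. f v)"
proof -
  let ?g = "\<lambda>v. indicator {0..} v * f v"
  have g: "integrable lborel ?g" using integrable_mult_indicator[OF _ int, of "{0..}"] by simp
  then have g': "integrable lborel (\<lambda>v. ?g (- v))"
    using lborel_integrable_real_affine[of ?g "-1" 0] by simp
  have "(LBINT v. f v) = (LBINT v. ?g v + ?g (- v))"
    by (rule integral_discrete_difference[of "{0}"]) (auto simp: indicator_def even)
  also have "\<dots> = (LBINT v. ?g v) + (LBINT v. ?g (- v))"
    using g g' by (rule Bochner_Integration.integral_add)
  also have "(LBINT v. ?g (- v)) = (LBINT v. ?g v)"
    using lborel_integral_real_affine[of "-1" ?g 0] by simp
  finally show ?thesis by (simp add: set_lebesgue_integral_def)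
qed

text \<open>
  Symmetrise \<open>K\<^sub>\<alpha>\<close> to an integral over the line, then translate by \<open>ln z\<close>.
\<close>

lemma bessel_K_eq_bessel_F:
  assumes "z > 0"
  shows "z powr \<alpha> * bessel_K \<alpha> z = bessel_F \<alpha> (z\<^sup>2)"
proof -
  define h where "h t = exp (- z * cosh t + \<alpha> * t)" for t
  have shift: "bessel_kernel \<alpha> (z\<^sup>2) (ln z + 1 * t) = z powr \<alpha> * h t" for t
  proof -
    have "exp (ln z + t) + z\<^sup>2 * exp (- (ln z + t)) = 2 * (z * cosh t)"
      using assms by (simp add: exp_add exp_diff exp_minus cosh_field_def power2_eq_square field_simps)
    then have "bessel_kernel \<alpha> (z\<^sup>2) (ln z + t) = exp (- z * cosh t + \<alpha> * (ln z + t))"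
      by (simp add: bessel_kernel_def)
    also have "\<dots> = z powr \<alpha> * h t"
      using assms by (simp add: h_def powr_def exp_add[symmetric] algebra_simps)
    finally show ?thesis by simp
  qed
  have int: "integrable lborel (bessel_kernel \<alpha> (z\<^sup>2))"
    using assms by (intro integrable_bessel_kernel) auto
  have inth: "integrable lborel h"
    using lborel_integrable_real_affine[OF int, of 1 "ln z"] assms unfolding shift by simp
  have inth': "integrable lborel (\<lambda>t. h (- t))"
    using lborel_integrable_real_affine[OF inth, of "-1" 0] by simp
  have cosh_eq: "exp (- z * cosh t) * cosh (\<alpha> * t) = (h t + h (- t)) / 2" for t
  proof -
    have "h t = exp (- z * cosh t) * exp (\<alpha> * t)" "h (- t) = exp (- z * cosh t) * exp (- (\<alpha> * t))"
      by (simp_all add: h_def flip: exp_add)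
    then show ?thesis by (simp add: cosh_field_def[of "\<alpha> * t"] distrib_left)
  qed
  have "(LBINT u. bessel_kernel \<alpha> (z\<^sup>2) u) = z powr \<alpha> * (LBINT t. h t)"
    by (subst lborel_integral_real_affine[of 1 _ "ln z"]) (simp_all only: shift, simp_all)
  also have "(LBINT t. h t) = (LBINT t. (h t + h (- t)) / 2)"
    using inth inth' lborel_integral_real_affine[of "-1" h 0] by simp
  also have "\<dots> = 2 * (LBINT t:{0..}. (h t + h (- t)) / 2)"
    using inth inth' by (intro integral_even_function) auto
  also have "(LBINT t:{0..}. (h t + h (- t)) / 2) = bessel_K \<alpha> z"
    unfolding bessel_K_def cosh_eq ..
  finally show ?thesis by (simp add: bessel_F_def)
qed

lemma tendsto_abs_powr_exp:
  fixes a k :: real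
  assumes "k > 0"
  shows "((\<lambda>v. \<bar>v\<bar> powr a * exp (- k * \<bar>v\<bar>)) \<longlongrightarrow> 0) at_top"
    "((\<lambda>v. \<bar>v\<bar> powr a * exp (- k * \<bar>v\<bar>)) \<longlongrightarrow> 0) at_bot"
proof -
  have "((\<lambda>x::real. x powr a * exp (- k * x)) \<longlongrightarrow> 0) at_top" using assms by real_asymp
  then have *: "((\<lambda>v::real. \<bar>v\<bar> powr a * exp (- k * \<bar>v\<bar>)) \<longlongrightarrow> 0) F" if "filterlim (\<lambda>u::real. \<bar>u\<bar>) at_top F" for F
    using that by (rule filterlim_compose)
  show "((\<lambda>v. \<bar>v\<bar> powr a * exp (- k * \<bar>v\<bar>)) \<longlongrightarrow> 0) at_top"
    "((\<lambda>v. \<bar>v\<bar> powr a * exp (- k * \<bar>v\<bar>)) \<longlongrightarrow> 0) at_bot"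
    by (intro *; real_asymp)+
qed

lemma powr_abs_mult_power:
  fixes v :: real
  assumes "v \<noteq> 0"
  shows "\<bar>v\<bar> powr a * \<bar>v ^ i\<bar> = \<bar>v\<bar> powr (a + real i)"
  using assms by (simp add: powr_add powr_realpow power_abs)

lemma exp_decay_times_poly_tendsto:
  fixes f :: "real \<Rightarrow> real"
  assumes "k > 0" and bound: "\<And>v. v \<noteq> 0 \<Longrightarrow> \<bar>f v\<bar> \<le> C * (\<bar>v\<bar> powr a * exp (- k * \<bar>v\<bar>))"
  shows "((\<lambda>v. f v * poly P v) \<longlongrightarrow> 0) at_top" "((\<lambda>v. f v * poly P v) \<longlongrightarrow> 0) at_bot"
proof -
  have "((\<lambda>v. f v * poly P v) \<longlongrightarrow> 0) F"
    if F: "\<And>b. ((\<lambda>v. \<bar>v\<bar> powr b * exp (- k * \<bar>v\<bar>)) \<longlongrightarrow> 0) F" "eventually (\<lambda>v. v \<noteq> 0) F" for F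
  proof -
    have "((\<lambda>v. f v * v ^ i) \<longlongrightarrow> 0) F" for i
    proof (rule Lim_null_comparison)
      show "eventually (\<lambda>v. norm (f v * v ^ i) \<le> C * (\<bar>v\<bar> powr (a + real i) * exp (- k * \<bar>v\<bar>))) F"
        using F(2)
      proof eventually_elim
        case (elim v)
        have "norm (f v * v ^ i) \<le> C * (\<bar>v\<bar> powr a * exp (- k * \<bar>v\<bar>)) * \<bar>v ^ i\<bar>"
          using bound[OF elim] by (simp add: abs_mult mult_right_mono)
        then show ?case by (simp add: powr_abs_mult_power[OF elim, symmetric] mult_ac)
      qed
      show "((\<lambda>v. C * (\<bar>v\<bar> powr (a + real i) * exp (- k * \<bar>v\<bar>))) \<longlongrightarrow> 0) F"
        using tendsto_mult[OF tendsto_const F(1)] by simp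
    qed
    then have "((\<lambda>v. \<Sum>i\<le>degree P. coeff P i * (f v * v ^ i)) \<longlongrightarrow> (\<Sum>i\<le>degree P. coeff P i * 0)) F"
      by (intro tendsto_intros)
    then show ?thesis by (simp add: poly_altdef sum_distrib_left mult_ac)
  qed
  from this[of at_top] this[of at_bot]
  show "((\<lambda>v. f v * poly P v) \<longlongrightarrow> 0) at_top" "((\<lambda>v. f v * poly P v) \<longlongrightarrow> 0) at_bot"
    using tendsto_abs_powr_exp[OF \<open>k > 0\<close>] by (simp_all add: eventually_at_top_not_equal eventually_at_bot_not_equal)
qed

lemma exp_decay_times_poly_integrable:
  fixes f :: "real \<Rightarrow> real"
  assumes "k > 0" "a > -1" and bound: "\<And>v. v \<noteq> 0 \<Longrightarrow> \<bar>f v\<bar> \<le> C * (\<bar>v\<bar> powr a * exp (- k * \<bar>v\<bar>))"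
    and [measurable]: "f \<in> borel_measurable borel"
  shows "integrable lborel (\<lambda>v. f v * poly P v)"
proof -
  have "integrable lborel (\<lambda>v. f v * v ^ i)" for i
  proof (rule Bochner_Integration.integrable_bound)
    show "integrable lborel (\<lambda>v. C * (\<bar>v\<bar> powr (a + real i) * exp (- k * \<bar>v\<bar>)))"
      using integrable_abs_powr_exp[of "a + real i" k] assms by simp
    have "norm (f v * v ^ i) \<le> norm (C * (\<bar>v\<bar> powr (a + real i) * exp (- k * \<bar>v\<bar>)))" if v: "v \<noteq> 0" for v
    proof -
      have "norm (f v * v ^ i) \<le> C * (\<bar>v\<bar> powr a * exp (- k * \<bar>v\<bar>)) * \<bar>v ^ i\<bar>"
        using bound[OF v] by (simp add: abs_mult mult_right_mono)
      also have "\<dots> = C * (\<bar>v\<bar> powr (a + real i) * exp (- k * \<bar>v\<bar>))"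
        by (simp add: powr_abs_mult_power[OF v, symmetric] mult_ac)
      finally show ?thesis by simp
    qed
    moreover have "AE v in lborel. v \<noteq> (0::real)" by (rule AE_lborel_singleton)
    ultimately show "AE v in lborel. norm (f v * v ^ i) \<le> norm (C * (\<bar>v\<bar> powr (a + real i) * exp (- k * \<bar>v\<bar>)))"
      by auto
  qed measurable
  then have "integrable lborel (\<lambda>v. \<Sum>i\<le>degree P. coeff P i * (f v * v ^ i))" by simp
  then show ?thesis by (simp add: poly_altdef sum_distrib_left mult_ac)
qed

section \<open>The primitive of the weighted Laguerre polynomials\<close>

context
  fixes \<nu> \<tau> c :: real
  assumes \<nu>: "\<nu> > -1" and \<tau>: "0 < \<tau>" "\<tau> < 1" and c: "c = 1 / (1 - \<tau>\<^sup>2)"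
begin

private lemma tau_sq: "\<tau>\<^sup>2 < 1"
  using \<tau> by (simp add: power2_eq_square mult_strict_mono' [of \<tau> 1 \<tau> 1, simplified])

private lemma c_pos: "c > 0" using tau_sq by (simp add: c)

private lemma c_mult: "c * (1 - \<tau>\<^sup>2) = 1" using tau_sq by (simp add: c)

text \<open>
  The weight with \<open>|y| K\<^bsub>\<nu>/2+1\<^esub>\<close> in place of \<open>K\<^bsub>\<nu>/2\<^esub>\<close>. Writing it through \<open>bessel_F\<close> gives the value at \<open>y = 0\<close> that
  makes it continuous.
\<close>

private definition raised_weight :: "real \<Rightarrow> real" where
  "raised_weight y = c powr - (\<nu> / 2 + 1) * bessel_F (\<nu> / 2 + 1) ((c * y)\<^sup>2) * exp (\<tau> * c * y)"

text \<open>
  Up to the factor \<open>c\<close>, the bracket \<open>\<tau> y K\<^bsub>\<nu>/2\<^esub> + |y| K\<^bsub>\<nu>/2+1\<^esub>\<close> in the claimed expansion, with its exponential and power factors.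
\<close>

private definition weight_primitive :: "real \<Rightarrow> real" where
  "weight_primitive y = c * raised_weight y + \<tau> * c * (y * weight \<nu> \<tau> y)"

text \<open>
  Up to a factor independent of \<open>y\<close>, the \<open>j\<close>-th summand of \<open>S\<^bsub>N,1\<^esub>\<close> plus that of its companion with the
  derivative of the kernel.
\<close>

private definition laguerre_primitive :: "int \<Rightarrow> real \<Rightarrow> real" where
  "laguerre_primitive j y = weight_primitive y * poly (laguerre_poly \<nu> j) (y / \<tau>)
    + y * weight \<nu> \<tau> y * (poly (pderiv (laguerre_poly \<nu> j)) (y / \<tau>) / \<tau>)"

private lemma scaled_bessel_K:
  assumes "y \<noteq> 0"
  shows "\<bar>y\<bar> powr \<alpha> * bessel_K \<alpha> (\<bar>y\<bar> / (1 - \<tau>\<^sup>2)) = c powr - \<alpha> * bessel_F \<alpha> ((c * y)\<^sup>2)"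
proof -
  have "c * \<bar>y\<bar> > 0" using c_pos assms by simp
  from bessel_K_eq_bessel_F[OF this, of \<alpha>]
  have "c powr \<alpha> * (\<bar>y\<bar> powr \<alpha> * bessel_K \<alpha> (c * \<bar>y\<bar>)) = bessel_F \<alpha> ((c * y)\<^sup>2)"
    using c_pos by (simp add: powr_mult power_mult_distrib mult_ac)
  moreover have "\<bar>y\<bar> / (1 - \<tau>\<^sup>2) = c * \<bar>y\<bar>" by (simp add: c)
  ultimately show ?thesis using c_pos by (simp add: powr_minus field_simps)
qed

private lemma weight_eq:
  assumes "y \<noteq> 0"
  shows "weight \<nu> \<tau> y = c powr - (\<nu> / 2) * bessel_F (\<nu> / 2) ((c * y)\<^sup>2) * exp (\<tau> * c * y)"
  using scaled_bessel_K[OF assms, of "\<nu> / 2"] by (simp add: weight_def c)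

private lemma raised_weight_eq:
  assumes "y \<noteq> 0"
  shows "raised_weight y = \<bar>y\<bar> powr (\<nu> / 2) * \<bar>y\<bar> * bessel_K (\<nu> / 2 + 1) (\<bar>y\<bar> / (1 - \<tau>\<^sup>2)) * exp (\<tau> * c * y)"
  using scaled_bessel_K[OF assms, of "\<nu> / 2 + 1"] assms by (simp add: raised_weight_def powr_add)

private lemma DERIV_raised_weight:
  assumes "y \<noteq> 0"
  shows "(raised_weight has_real_derivative \<tau> * c * raised_weight y - c * (y * weight \<nu> \<tau> y)) (at y)"
proof -
  have "(c * y)\<^sup>2 > 0" using c_pos assms by simp
  have "((\<lambda>y. bessel_F (\<nu> / 2 + 1) ((c * y)\<^sup>2)) has_real_derivative
      (- bessel_F (\<nu> / 2) ((c * y)\<^sup>2) / 2) * (2 * c\<^sup>2 * y)) (at y)"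
    using DERIV_bessel_F[OF \<open>(c * y)\<^sup>2 > 0\<close>, of "\<nu> / 2 + 1"]
    by (intro DERIV_chain2[where f = "bessel_F (\<nu> / 2 + 1)"])
      (auto intro!: derivative_eq_intros simp: power2_eq_square)
  then have "(raised_weight has_real_derivative
      c powr - (\<nu> / 2 + 1) * ((- bessel_F (\<nu> / 2) ((c * y)\<^sup>2) / 2) * (2 * c\<^sup>2 * y) * exp (\<tau> * c * y)
        + bessel_F (\<nu> / 2 + 1) ((c * y)\<^sup>2) * (\<tau> * c * exp (\<tau> * c * y)))) (at y)"
    unfolding raised_weight_def by (auto intro!: derivative_eq_intros simp: algebra_simps)
  moreover have "c powr - (\<nu> / 2 + 1) * c = c powr - (\<nu> / 2)"
    using c_pos powr_add[of c "- (\<nu> / 2 + 1)" 1] by simp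
  then have "c powr - (\<nu> / 2 + 1) * c\<^sup>2 = c powr - (\<nu> / 2) * c"
    by (simp add: power2_eq_square flip: mult.assoc)
  then have "c powr - (\<nu> / 2 + 1) * ((- bessel_F (\<nu> / 2) ((c * y)\<^sup>2) / 2) * (2 * c\<^sup>2 * y) * exp (\<tau> * c * y)
        + bessel_F (\<nu> / 2 + 1) ((c * y)\<^sup>2) * (\<tau> * c * exp (\<tau> * c * y)))
     = \<tau> * c * raised_weight y - c * (y * weight \<nu> \<tau> y)"
    unfolding raised_weight_def weight_eq[OF assms] by (simp add: algebra_simps)
  ultimately show ?thesis by simp
qed

private lemma DERIV_weight:
  assumes "y \<noteq> 0"
  shows "(weight \<nu> \<tau> has_real_derivative ((\<nu> + \<tau> * c * y) * weight \<nu> \<tau> y - c * raised_weight y) / y) (at y)"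
proof -
  let ?s = "(c * y)\<^sup>2"
  have s: "?s > 0" using c_pos assms by simp
  have "((\<lambda>y. bessel_F (\<nu> / 2) ((c * y)\<^sup>2)) has_real_derivative
      (- bessel_F (\<nu> / 2 - 1) ?s / 2) * (2 * c\<^sup>2 * y)) (at y)"
    using DERIV_bessel_F[OF s, of "\<nu> / 2"]
    by (intro DERIV_chain2[where f = "bessel_F (\<nu> / 2)"])
      (auto intro!: derivative_eq_intros simp: power2_eq_square)
  then have "((\<lambda>y. c powr - (\<nu> / 2) * bessel_F (\<nu> / 2) ((c * y)\<^sup>2) * exp (\<tau> * c * y)) has_real_derivative
      c powr - (\<nu> / 2) * ((- bessel_F (\<nu> / 2 - 1) ?s / 2) * (2 * c\<^sup>2 * y) * exp (\<tau> * c * y)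
        + bessel_F (\<nu> / 2) ?s * (\<tau> * c * exp (\<tau> * c * y)))) (at y)"
    by (auto intro!: derivative_eq_intros simp: algebra_simps)
  moreover have "c powr - (\<nu> / 2 + 1) * c = c powr - (\<nu> / 2)"
    using c_pos powr_add[of c "- (\<nu> / 2 + 1)" 1] by simp
  then have cB: "c * raised_weight y = c powr - (\<nu> / 2) * bessel_F (\<nu> / 2 + 1) ?s * exp (\<tau> * c * y)"
    unfolding raised_weight_def by (metis mult.commute mult.left_commute)
  have "bessel_F (\<nu> / 2 + 1) ?s = (c\<^sup>2 * y * bessel_F (\<nu> / 2 - 1) ?s) * y + \<nu> * bessel_F (\<nu> / 2) ?s"
    using bessel_F_recurrence[OF s, of "\<nu> / 2"] by (simp add: power2_eq_square mult_ac)
  then have "c powr - (\<nu> / 2) * ((- bessel_F (\<nu> / 2 - 1) ?s / 2) * (2 * c\<^sup>2 * y) * exp (\<tau> * c * y)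
        + bessel_F (\<nu> / 2) ?s * (\<tau> * c * exp (\<tau> * c * y)))
     = ((\<nu> + \<tau> * c * y) * weight \<nu> \<tau> y - c * raised_weight y) / y"
    unfolding cB weight_eq[OF assms] using assms by (simp add: field_simps)
  ultimately have "((\<lambda>y. c powr - (\<nu> / 2) * bessel_F (\<nu> / 2) ((c * y)\<^sup>2) * exp (\<tau> * c * y)) has_real_derivative
      ((\<nu> + \<tau> * c * y) * weight \<nu> \<tau> y - c * raised_weight y) / y) (at y)" by simp
  moreover have "eventually (\<lambda>u. weight \<nu> \<tau> u = c powr - (\<nu> / 2) * bessel_F (\<nu> / 2) ((c * u)\<^sup>2) * exp (\<tau> * c * u)) (nhds y)"
    by (rule eventually_mono[OF eventually_nhds_in_open[of "- {0}" y]])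
      (use assms in \<open>auto simp: weight_eq open_Compl\<close>)
  ultimately show ?thesis by (subst DERIV_cong_ev[OF refl _ refl])
qed

text \<open>
  The terms with the raised Bessel order cancel between the two summands, and \<open>c (1 - \<tau>\<^sup>2) = 1\<close> simplifies the rest.
\<close>

private lemma DERIV_weight_primitive:
  assumes "y \<noteq> 0"
  shows "(weight_primitive has_real_derivative c * weight \<nu> \<tau> y * (\<tau> * (1 + \<nu>) - y)) (at y)"
proof -
  let ?w = "weight \<nu> \<tau> y"
  have "(weight_primitive has_real_derivative c * (\<tau> * c * raised_weight y - c * (y * ?w))
      + \<tau> * c * (?w + y * (((\<nu> + \<tau> * c * y) * ?w - c * raised_weight y) / y))) (at y)"
    unfolding weight_primitive_def using DERIV_raised_weight[OF assms] DERIV_weight[OF assms]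
    by (auto intro!: derivative_eq_intros simp: algebra_simps)
  moreover have "c * (\<tau> * c * raised_weight y - c * (y * ?w)) + \<tau> * c * (?w + y * (((\<nu> + \<tau> * c * y) * ?w - c * raised_weight y) / y))
    = c * ?w * (\<tau> * (1 + \<nu>) - (c * (1 - \<tau>\<^sup>2)) * y)"
    unfolding nonzero_mult_div_cancel_left[OF assms] times_divide_eq_right
    by (simp add: algebra_simps power2_eq_square)
  ultimately show ?thesis by (simp add: c_mult)
qed

private lemma DERIV_laguerre_primitive:
  assumes "y \<noteq> 0" "j \<ge> 0"
  shows "(laguerre_primitive j has_real_derivative c * (\<tau> * (of_int j + 1) * (weight \<nu> \<tau> y * laguerre \<nu> (j + 1) (y / \<tau>))
     - (of_int j + \<nu>) / \<tau> * (weight \<nu> \<tau> y * laguerre \<nu> (j - 1) (y / \<tau>)))) (at y)"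
proof -
  let ?w = "weight \<nu> \<tau> y" and ?z = "y / \<tau>"
  let ?L = "poly (laguerre_poly \<nu> j) ?z" and ?L' = "poly (pderiv (laguerre_poly \<nu> j)) ?z"
    and ?L'' = "poly (pderiv (pderiv (laguerre_poly \<nu> j))) ?z"
  let ?D = "c * ?w * (\<tau> * (1 + \<nu>) - y) * ?L + weight_primitive y * (?L' / \<tau>)
    + (?w + y * (((\<nu> + \<tau> * c * y) * ?w - c * raised_weight y) / y)) * (?L' / \<tau>) + y * ?w * (?L'' / \<tau> / \<tau>)"
  have L: "((\<lambda>y. poly P (y / \<tau>)) has_real_derivative poly (pderiv P) ?z / \<tau>) (at y)" for P
    by (rule DERIV_chain2[OF poly_DERIV, THEN DERIV_cong]) (use \<tau> in \<open>auto intro!: derivative_eq_intros\<close>)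
  have "(laguerre_primitive j has_real_derivative ?D) (at y)"
    unfolding laguerre_primitive_def
    by (rule DERIV_add[OF DERIV_mult[OF DERIV_weight_primitive L] DERIV_mult[OF DERIV_mult[OF DERIV_ident DERIV_weight]
            DERIV_cdivide[OF L]], THEN DERIV_cong]) (use assms in \<open>simp_all add: mult_ac\<close>)
  moreover have "?D = c * (\<tau> * (of_int j + 1) * (?w * laguerre \<nu> (j + 1) ?z) - (of_int j + \<nu>) / \<tau> * (?w * laguerre \<nu> (j - 1) ?z))"
  proof -
    have "?D = ?w * (y / \<tau>\<^sup>2 * ?L'' + (1 + \<nu> + 2 * \<tau> * c * y) / \<tau> * ?L' + c * (\<tau> * (1 + \<nu>) - y) * ?L)"
      using assms(1) \<tau> by (simp add: weight_primitive_def power2_eq_square add_divide_distrib diff_divide_distrib algebra_simps)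
    also have "y / \<tau>\<^sup>2 * ?L'' + (1 + \<nu> + 2 * \<tau> * c * y) / \<tau> * ?L' + c * (\<tau> * (1 + \<nu>) - y) * ?L
      = ((c * (1 - \<tau>\<^sup>2)) * ?z * ?L'' + ((c * (1 - \<tau>\<^sup>2)) * (1 + \<nu>) + 2 * c * \<tau>\<^sup>2 * ?z) * ?L'
        + c * \<tau>\<^sup>2 * (1 + \<nu> - ?z) * ?L) / \<tau>"
      unfolding c_mult using \<tau> by (simp add: power2_eq_square add_divide_distrib diff_divide_distrib algebra_simps)
    also have "\<dots> = c * ((1 - \<tau>\<^sup>2) * ?z * ?L'' + ((1 - \<tau>\<^sup>2) * (1 + \<nu>) + 2 * \<tau>\<^sup>2 * ?z) * ?L'
        + \<tau>\<^sup>2 * (1 + \<nu> - ?z) * ?L) / \<tau>"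
      by (simp only: algebra_simps)
    also have "\<dots> = c * (\<tau>\<^sup>2 * (of_int j + 1) * laguerre \<nu> (j + 1) ?z - (of_int j + \<nu>) * laguerre \<nu> (j - 1) ?z) / \<tau>"
      by (simp only: laguerre_operator[OF \<nu> assms(2)])
    finally show ?thesis using \<tau> by (simp add: power2_eq_square field_simps)
  qed
  ultimately show ?thesis by simp
qed

text \<open>
  The factor \<open>e\<^bsup>\<tau> c y\<^esup>\<close> costs a fraction \<open>\<tau> < 1\<close> of the decay \<open>e\<^bsup>-c |y|\<^esup>\<close>; giving up \<open>\<epsilon> = (1 - \<tau>)/2\<close> in
  \<open>bessel_F_bound\<close> leaves the rate \<open>c (1 - \<tau>)/2\<close>.
\<close>

private lemma bessel_F_exp_bound:
  assumes "0 \<le> \<beta>" "\<beta> \<le> 1" "\<alpha> + \<beta> > 0"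
  obtains C where "C \<ge> 0"
    "\<And>y. y \<noteq> 0 \<Longrightarrow> bessel_F \<alpha> ((c * y)\<^sup>2) * exp (\<tau> * c * y)
      \<le> C * (\<bar>y\<bar> powr (- 2 * \<beta>) * exp (- (c * (1 - \<tau>) / 2) * \<bar>y\<bar>))"
proof -
  obtain C where C: "C \<ge> 0"
    "\<And>s. s > 0 \<Longrightarrow> bessel_F \<alpha> s \<le> C * s powr (- \<beta>) * exp (- (1 - (1 - \<tau>) / 2) * sqrt s)"
    using bessel_F_bound[OF assms, of "(1 - \<tau>) / 2"] \<tau> by auto
  have "bessel_F \<alpha> ((c * y)\<^sup>2) * exp (\<tau> * c * y)
      \<le> (C * c powr (- 2 * \<beta>)) * (\<bar>y\<bar> powr (- 2 * \<beta>) * exp (- (c * (1 - \<tau>) / 2) * \<bar>y\<bar>))" if "y \<noteq> 0" for y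
  proof -
    have p: "((c * y)\<^sup>2) powr (- \<beta>) = c powr (- 2 * \<beta>) * \<bar>y\<bar> powr (- 2 * \<beta>)"
    proof -
      have "(c * y)\<^sup>2 = (c * \<bar>y\<bar>) powr 2"
        using c_pos that by (simp add: powr_numeral power_mult_distrib)
      then have "((c * y)\<^sup>2) powr (- \<beta>) = (c * \<bar>y\<bar>) powr (- 2 * \<beta>)"
        by (simp only: powr_powr) simp
      then show ?thesis using c_pos by (simp add: powr_mult)
    qed
    have "bessel_F \<alpha> ((c * y)\<^sup>2) * exp (\<tau> * c * y)
      \<le> (C * ((c * y)\<^sup>2) powr (- \<beta>) * exp (- (1 - (1 - \<tau>) / 2) * (c * \<bar>y\<bar>))) * exp (\<tau> * c * \<bar>y\<bar>)"
      using C(1) C(2)[of "(c * y)\<^sup>2"] bessel_F_nonneg c_pos \<tau> that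
      by (intro mult_mono) (auto simp: abs_mult)
    also have "\<dots> = C * ((c * y)\<^sup>2) powr (- \<beta>) * exp (- (1 - (1 - \<tau>) / 2) * (c * \<bar>y\<bar>) + \<tau> * c * \<bar>y\<bar>)"
      by (simp add: exp_add)
    also have "- (1 - (1 - \<tau>) / 2) * (c * \<bar>y\<bar>) + \<tau> * c * \<bar>y\<bar> = - (c * (1 - \<tau>) / 2) * \<bar>y\<bar>"
      by (simp add: field_simps)
    finally show ?thesis unfolding p by (simp add: mult_ac)
  qed
  then show ?thesis using C(1) by (intro that[of "C * c powr (- 2 * \<beta>)"]) auto
qed

text \<open>
  The singularity is \<open>|y|\<^bsup>-2\<beta>\<^esup>\<close>. The exponent must satisfy \<open>-\<nu>/2 < \<beta>\<close> for the bound on \<open>bessel_F\<close> and \<open>2 \<beta> < 1\<close> for integrability at the origin. Both are possible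
  exactly because \<open>\<nu> > -1\<close>.
\<close>

private lemma weight_bound:
  obtains C a where "C \<ge> 0" "a > -1"
    "\<And>y. y \<noteq> 0 \<Longrightarrow> \<bar>weight \<nu> \<tau> y\<bar> \<le> C * (\<bar>y\<bar> powr a * exp (- (c * (1 - \<tau>) / 2) * \<bar>y\<bar>))"
proof -
  define \<beta> where "\<beta> = (if \<nu> \<ge> 0 then 1/4 else (1 - \<nu>) / 4)"
  have \<beta>: "0 \<le> \<beta>" "\<beta> < 1/2" "\<nu> / 2 + \<beta> > 0" using \<nu> by (auto simp: \<beta>_def field_simps)
  then obtain C where C: "C \<ge> 0"
    "\<And>y. y \<noteq> 0 \<Longrightarrow> bessel_F (\<nu> / 2) ((c * y)\<^sup>2) * exp (\<tau> * c * y)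
      \<le> C * (\<bar>y\<bar> powr (- 2 * \<beta>) * exp (- (c * (1 - \<tau>) / 2) * \<bar>y\<bar>))"
    using bessel_F_exp_bound[of \<beta> "\<nu> / 2"] by auto
  have "\<bar>weight \<nu> \<tau> y\<bar> \<le> (c powr - (\<nu> / 2) * C) * (\<bar>y\<bar> powr (- 2 * \<beta>) * exp (- (c * (1 - \<tau>) / 2) * \<bar>y\<bar>))"
    if "y \<noteq> 0" for y
  proof -
    have "\<bar>weight \<nu> \<tau> y\<bar> = c powr - (\<nu> / 2) * (bessel_F (\<nu> / 2) ((c * y)\<^sup>2) * exp (\<tau> * c * y))"
      using bessel_F_nonneg by (simp add: weight_eq[OF that] abs_mult)
    also have "\<dots> \<le> c powr - (\<nu> / 2) * (C * (\<bar>y\<bar> powr (- 2 * \<beta>) * exp (- (c * (1 - \<tau>) / 2) * \<bar>y\<bar>)))"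
      by (intro mult_left_mono C(2) that) simp
    finally show ?thesis by (simp add: mult_ac)
  qed
  then show ?thesis using C(1) \<beta> by (intro that[of "c powr - (\<nu> / 2) * C" "- 2 * \<beta>"]) auto
qed

private lemma decay_pos: "c * (1 - \<tau>) / 2 > 0" using c_pos \<tau> by simp

private lemma isCont_raised_weight: "isCont raised_weight y"
proof -
  have "continuous_on UNIV (\<lambda>y. bessel_F (\<nu> / 2 + 1) ((c * y)\<^sup>2))"
    by (rule continuous_on_compose2[OF continuous_on_bessel_F[of 0]])
      (use \<nu> in \<open>auto intro!: continuous_intros\<close>)
  then have "continuous_on UNIV raised_weight" unfolding raised_weight_def by (intro continuous_intros)
  then show ?thesis by (simp add: continuous_on_eq_continuous_at)
qed

private lemma isCont_mult_weight: "isCont (\<lambda>y. y * weight \<nu> \<tau> y) y"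
proof (cases "y = 0")
  case True
  obtain C a where C: "C \<ge> 0" "a > -1"
    "\<And>y. y \<noteq> 0 \<Longrightarrow> \<bar>weight \<nu> \<tau> y\<bar> \<le> C * (\<bar>y\<bar> powr a * exp (- (c * (1 - \<tau>) / 2) * \<bar>y\<bar>))"
    using weight_bound by metis
  have "((\<lambda>y. y * weight \<nu> \<tau> y) \<longlongrightarrow> 0) (at 0)"
  proof (rule Lim_null_comparison)
    have "norm (y * weight \<nu> \<tau> y) \<le> C * \<bar>y\<bar> powr (a + 1)" if "y \<noteq> 0" for y
    proof -
      have "\<bar>weight \<nu> \<tau> y\<bar> \<le> C * (\<bar>y\<bar> powr a * exp (- (c * (1 - \<tau>) / 2) * \<bar>y\<bar>))"
        by (rule C(3)[OF that])
      also have "\<dots> \<le> C * (\<bar>y\<bar> powr a * 1)"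
        using C(1) decay_pos by (intro mult_left_mono) auto
      finally have "norm (y * weight \<nu> \<tau> y) \<le> \<bar>y\<bar> * (C * (\<bar>y\<bar> powr a * 1))"
        by (simp add: abs_mult mult_left_mono)
      then show ?thesis using that by (simp add: powr_add mult_ac)
    qed
    then show "eventually (\<lambda>y. norm (y * weight \<nu> \<tau> y) \<le> C * \<bar>y\<bar> powr (a + 1)) (at 0)"
      by (simp add: eventually_at_filter)
    have "((\<lambda>y. C * \<bar>y\<bar> powr (a + 1)) \<longlongrightarrow> C * \<bar>0\<bar> powr (a + 1)) (at (0::real))"
      using C(2) by (intro tendsto_intros tendsto_powr') auto
    then show "((\<lambda>y. C * \<bar>y\<bar> powr (a + 1)) \<longlongrightarrow> 0) (at (0::real))" by simp
  qed
  then show ?thesis using True by (simp add: isCont_def)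
next
  case False
  then show ?thesis using DERIV_isCont[OF DERIV_weight[OF False]] by (intro continuous_intros)
qed

private lemma isCont_laguerre_primitive: "isCont (laguerre_primitive j) y"
  unfolding laguerre_primitive_def weight_primitive_def
  by (intro continuous_intros isCont_raised_weight isCont_mult_weight isCont_o2[OF _ poly_isCont]) (use \<tau> in auto)

private lemma weight_measurable: "weight \<nu> \<tau> \<in> borel_measurable borel"
proof (rule borel_measurable_continuous_countable_exceptions[of "{0}"])
  show "continuous_on (- {0}) (weight \<nu> \<tau>)"
    by (intro continuous_at_imp_continuous_on ballI DERIV_isCont[OF DERIV_weight]) auto
qed simp

lemma integrable_weight_poly: "integrable lborel (\<lambda>v. weight \<nu> \<tau> v * poly P v)"
proof -
  obtain C a where "C \<ge> 0" "a > -1"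
    "\<And>y. y \<noteq> 0 \<Longrightarrow> \<bar>weight \<nu> \<tau> y\<bar> \<le> C * (\<bar>y\<bar> powr a * exp (- (c * (1 - \<tau>) / 2) * \<bar>y\<bar>))"
    using weight_bound by metis
  then show ?thesis
    by (intro exp_decay_times_poly_integrable[OF decay_pos] weight_measurable) auto
qed

private lemma poly_rescale: "poly P (y / \<tau>) = poly (pcompose P [:0, 1 / \<tau>:]) y"
  by (simp add: poly_pcompose)

lemma integrable_weight_laguerre: "integrable lborel (\<lambda>v. weight \<nu> \<tau> v * laguerre \<nu> j (v / \<tau>))"
  unfolding poly_laguerre_poly[symmetric] poly_rescale by (rule integrable_weight_poly)

private lemma laguerre_primitive_tendsto: "(laguerre_primitive j \<longlongrightarrow> 0) at_top" "(laguerre_primitive j \<longlongrightarrow> 0) at_bot"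
proof -
  obtain C a where C: "C \<ge> 0"
    "\<And>y. y \<noteq> 0 \<Longrightarrow> \<bar>weight \<nu> \<tau> y\<bar> \<le> C * (\<bar>y\<bar> powr a * exp (- (c * (1 - \<tau>) / 2) * \<bar>y\<bar>))"
    using weight_bound by metis
  obtain D where D: "D \<ge> 0"
    "\<And>y. y \<noteq> 0 \<Longrightarrow> bessel_F (\<nu> / 2 + 1) ((c * y)\<^sup>2) * exp (\<tau> * c * y)
      \<le> D * (\<bar>y\<bar> powr (- 2 * 0) * exp (- (c * (1 - \<tau>) / 2) * \<bar>y\<bar>))"
    using bessel_F_exp_bound[of 0 "\<nu> / 2 + 1"] \<nu> by auto
  have rw_bound: "\<bar>raised_weight y\<bar> \<le> (c powr - (\<nu> / 2 + 1) * D) * (\<bar>y\<bar> powr (- 2 * 0) * exp (- (c * (1 - \<tau>) / 2) * \<bar>y\<bar>))"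
    if "y \<noteq> 0" for y
  proof -
    have "\<bar>raised_weight y\<bar> = c powr - (\<nu> / 2 + 1) * (bessel_F (\<nu> / 2 + 1) ((c * y)\<^sup>2) * exp (\<tau> * c * y))"
      using bessel_F_nonneg by (simp add: raised_weight_def abs_mult)
    also have "\<dots> \<le> c powr - (\<nu> / 2 + 1) * (D * (\<bar>y\<bar> powr (- 2 * 0) * exp (- (c * (1 - \<tau>) / 2) * \<bar>y\<bar>)))"
      by (intro mult_left_mono D(2) that) simp
    finally show ?thesis by (simp add: mult_ac)
  qed
  define P where "P = pcompose (laguerre_poly \<nu> j) [:0, 1 / \<tau>:]"
  define P' where "P' = pcompose (pderiv (laguerre_poly \<nu> j)) [:0, 1 / \<tau>:]"
  have primitive_eq: "laguerre_primitive j = (\<lambda>y. c * (raised_weight y * poly P y)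
      + weight \<nu> \<tau> y * poly ([:0, 1:] * (smult (\<tau> * c) P + smult (1 / \<tau>) P')) y)"
    by (simp add: fun_eq_iff laguerre_primitive_def weight_primitive_def poly_rescale P_def P'_def algebra_simps)
  show "(laguerre_primitive j \<longlongrightarrow> 0) at_top" "(laguerre_primitive j \<longlongrightarrow> 0) at_bot"
    unfolding primitive_eq
    using exp_decay_times_poly_tendsto[OF decay_pos C(2)] exp_decay_times_poly_tendsto[OF decay_pos rw_bound]
    by (intro tendsto_add_zero tendsto_mult_right_zero; blast)+
qed

lemma integrable_sgn_weight_laguerre:
  "integrable lborel (\<lambda>v. sgn (y - v) * (weight \<nu> \<tau> v * laguerre \<nu> j (v / \<tau>)))"
  by (rule Bochner_Integration.integrable_bound[OF integrable_weight_laguerre[of j]])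
    (use borel_measurable_integrable[OF integrable_weight_laguerre[of j]] in \<open>auto simp: abs_mult sgn_real_def\<close>)

text \<open>
  The analytic core: twice the primitive at \<open>y\<close> is a combination of the signed integrals of the two
  neighbouring Laguerre polynomials. For even \<open>j\<close> the left-hand side is a multiple of \<open>\<Phi>\<^bsub>j+1\<^esub>(y)\<close>.
\<close>

lemma integral_sgn_weight_laguerre:
  assumes "j \<ge> 0" "y \<noteq> 0"
  defines "\<Psi> \<equiv> \<lambda>i. LBINT v. sgn (y - v) * (weight \<nu> \<tau> v * laguerre \<nu> i (v / \<tau>))"
  shows "c * (\<tau> * (of_int j + 1) * \<Psi> (j + 1) - (of_int j + \<nu>) / \<tau> * \<Psi> (j - 1)) = 
    2 * ((c * (\<bar>y\<bar> powr (\<nu> / 2) * \<bar>y\<bar> * bessel_K (\<nu> / 2 + 1) (\<bar>y\<bar> / (1 - \<tau>\<^sup>2)) * exp (\<tau> * c * y))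
          + \<tau> * c * (y * weight \<nu> \<tau> y)) * laguerre \<nu> j (y / \<tau>)
      + y * weight \<nu> \<tau> y * (poly (pderiv (laguerre_poly \<nu> j)) (y / \<tau>) / \<tau>))"
proof -
  let ?g = "\<lambda>i v. weight \<nu> \<tau> v * laguerre \<nu> i (v / \<tau>)"
  have "2 * laguerre_primitive j y = (LBINT v. sgn (y - v) * (c * (\<tau> * (of_int j + 1) * ?g (j + 1) v - (of_int j + \<nu>) / \<tau> * ?g (j - 1) v)))"
  proof (rule integral_sgn_times_derivative[symmetric, where S = "{0}"])
    show "integrable lborel (\<lambda>v. c * (\<tau> * (of_int j + 1) * ?g (j + 1) v - (of_int j + \<nu>) / \<tau> * ?g (j - 1) v))"
      by (intro integrable_mult_right Bochner_Integration.integrable_diff integrable_weight_laguerre)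
    show "(laguerre_primitive j has_real_derivative c * (\<tau> * (of_int j + 1) * ?g (j + 1) v - (of_int j + \<nu>) / \<tau> * ?g (j - 1) v)) (at v)"
      if "v \<notin> {0}" for v
      using that DERIV_laguerre_primitive[OF _ assms(1)] by blast
  qed (simp_all add: isCont_laguerre_primitive laguerre_primitive_tendsto)
  also have "\<dots> = (LBINT v. c * (\<tau> * (of_int j + 1) * (sgn (y - v) * ?g (j + 1) v) - (of_int j + \<nu>) / \<tau> * (sgn (y - v) * ?g (j - 1) v)))"
    by (rule arg_cong[where f = "integral\<^sup>L lborel"]) (simp add: fun_eq_iff algebra_simps)
  also have "\<dots> = c * (\<tau> * (of_int j + 1) * \<Psi> (j + 1) - (of_int j + \<nu>) / \<tau> * \<Psi> (j - 1))"
    unfolding \<Psi>_def using integrable_sgn_weight_laguerre by simp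
  finally show ?thesis by (simp add: laguerre_primitive_def weight_primitive_def raised_weight_eq[OF assms(2)] poly_laguerre_poly)
qed

end

section \<open>The telescoping sum\<close>

text \<open>
  Here \<open>\<phi> i\<close>, \<open>\<psi> i\<close> and \<open>H i\<close> stand for \<open>L\<^sub>i(x/\<tau>)\<close>, the signed integral of the weighted \<open>L\<^sub>i\<close>, and
  the primitive at \<open>y\<close>. The \<open>j\<close>-th summand on the left contains the kernel term of
  the even index \<open>2j\<close>, a cross term \<open>\<phi>\<^bsub>2j+1\<^esub> \<psi>\<^bsub>2j\<^esub>\<close> and a cross term \<open>\<phi>\<^bsub>2j-1\<^esub> \<psi>\<^bsub>2j\<^esub>\<close>. By the relation for \<open>H\<close>, the kernel term
  of the odd index \<open>2j+1\<close> equals the sum of the cross terms in \<open>\<phi>\<^bsub>2j+1\<^esub>\<close> from the summands \<open>j\<close> and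
  \<open>j+1\<close>. So all cross terms are absorbed but the last one, which is the rank-one correction.
\<close>

lemma laguerre_skew_sum_telescopes:
  fixes \<phi> \<psi> H :: "int \<Rightarrow> real"
  assumes "\<nu> > -1" "\<tau> > 0" "c > 0" and "\<phi> (- 1) = 0"
    and H: "\<And>j. j \<ge> 0 \<Longrightarrow> 2 * H j = c * (\<tau> * (of_int j + 1) * \<psi> (j + 1) - (of_int j + \<nu>) / \<tau> * \<psi> (j - 1))"
  shows "(\<Sum>j<Suc M. c * fact (2 * j) * \<tau> ^ (4 * j) / (2 * pi * Gamma (2 * real j + 1 + \<nu>))
      * (2 / c * \<phi> (2 * int j) * H (2 * int j)
         - (\<tau> * (2 * real j + 1) * \<phi> (2 * int j + 1) - (2 * real j + \<nu>) / \<tau> * \<phi> (2 * int j - 1)) * \<psi> (2 * int j)))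
    = (\<Sum>k<2 * M + 1. fact k * \<tau> ^ (2 * k) / Gamma (real k + \<nu> + 1) * \<phi> (int k) * H (int k)) / pi
      - c * \<tau> ^ (4 * M + 1) * fact (2 * M + 1) / (2 * pi * Gamma (2 * real M + 1 + \<nu>))
        * \<phi> (2 * int M + 1) * \<psi> (2 * int M)"
proof -
  define b where "b k = fact k * \<tau> ^ (2 * k) / Gamma (real k + \<nu> + 1) * \<phi> (int k) * H (int k)" for k
  define T where "T j = c * fact (2 * j) * \<tau> ^ (4 * j) / (2 * pi * Gamma (2 * real j + 1 + \<nu>))
      * (2 / c * \<phi> (2 * int j) * H (2 * int j)
         - (\<tau> * (2 * real j + 1) * \<phi> (2 * int j + 1) - (2 * real j + \<nu>) / \<tau> * \<phi> (2 * int j - 1)) * \<psi> (2 * int j))"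
    for j
  define E where "E j = c * \<tau> ^ (4 * j + 1) * fact (2 * j + 1) / (2 * pi * Gamma (2 * real j + 1 + \<nu>))
        * \<phi> (2 * int j + 1) * \<psi> (2 * int j)" for j
  define X where "X j = c * fact (2 * j) * \<tau> ^ (4 * j) / (2 * pi * Gamma (2 * real j + 1 + \<nu>))
        * ((2 * real j + \<nu>) / \<tau>) * \<psi> (2 * int j)" for j
  \<comment> \<open>The summand splits into its even kernel term \<open>b\<close> and the cross terms \<open>E\<close> and \<open>X\<close>.\<close>
  have T: "T j = b (2 * j) / pi - E j + \<phi> (2 * int j - 1) * X j" for j
  proof -
    have "Gamma (2 * real j + 1 + \<nu>) > 0" using assms by (intro Gamma_real_pos) auto
    moreover have "real (2 * j) + \<nu> + 1 = 2 * real j + 1 + \<nu>" "2 * (2 * j) = 4 * j" "int (2 * j) = 2 * int j"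
      "fact (2 * j + 1) = (2 * real j + 1) * fact (2 * j)" "\<tau> ^ (4 * j + 1) = \<tau> * \<tau> ^ (4 * j)"
      by simp_all
    ultimately show ?thesis
      using \<open>c > 0\<close> \<open>\<tau> > 0\<close> unfolding T_def b_def E_def X_def
      by (simp only:) (simp add: field_simps)
  qed
  \<comment> \<open>An odd kernel term consists of one cross term of each of two consecutive summands.\<close>
  have odd: "b (2 * M + 1) / pi + E M = \<phi> (2 * int M + 1) * X (Suc M)" for M
  proof -
    define g where "g = Gamma (2 * real M + 1 + \<nu>)"
    have "g > 0" unfolding g_def using assms by (intro Gamma_real_pos) auto
    have g1: "Gamma (2 * real M + 2 + \<nu>) = (2 * real M + 1 + \<nu>) * g"
      unfolding g_def using Gamma_real_plus1[of "2 * real M + 1 + \<nu>"] assms by (simp add: algebra_simps)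
    have g2: "Gamma (2 * real M + 3 + \<nu>) = (2 * real M + 2 + \<nu>) * ((2 * real M + 1 + \<nu>) * g)"
      unfolding g1[symmetric] using Gamma_real_plus1[of "2 * real M + 2 + \<nu>"] assms by (simp add: algebra_simps)
    define n where "n = 2 * real M"
    define f where "f = (fact (2 * M + 1) :: real)"
    have f1: "fact (2 * M + 2) = (n + 2) * f" by (simp add: f_def n_def algebra_simps)
    define t where "t = \<tau> ^ (4 * M)"
    define p where "p = \<phi> (2 * int M + 1)"
    define u where "u = \<psi> (2 * int M)"
    define v where "v = \<psi> (2 * int M + 2)"
    have Hodd: "H (2 * int M + 1) = c / 2 * (\<tau> * (n + 2) * v - (n + 1 + \<nu>) / \<tau> * u)"
    proof -
      have "real_of_int (2 * int M + 1) + 1 = n + 2" "real_of_int (2 * int M + 1) + \<nu> = n + 1 + \<nu>"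
        "2 * int M + 1 + 1 = 2 * int M + 2" "2 * int M + 1 - 1 = 2 * int M" by (simp_all add: n_def)
      then have "2 * H (2 * int M + 1) = c * (\<tau> * (n + 2) * v - (n + 1 + \<nu>) / \<tau> * u)"
        using H[of "2 * int M + 1"] by (simp only: u_def v_def)
      then show ?thesis by simp
    qed
    have pos: "n + 1 + \<nu> > 0" "n + 2 + \<nu> > 0" using assms by (auto simp: n_def)
    have b: "b (2 * M + 1) = f * (t * \<tau>\<^sup>2) / ((n + 1 + \<nu>) * g) * p * (c / 2 * (\<tau> * (n + 2) * v - (n + 1 + \<nu>) / \<tau> * u))"
    proof -
      have "real (2 * M + 1) + \<nu> + 1 = 2 * real M + 2 + \<nu>" "2 * (2 * M + 1) = 4 * M + 2" "int (2 * M + 1) = 2 * int M + 1"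
        by simp_all
      then show ?thesis unfolding b_def by (simp only: g1 Hodd power_add f_def t_def p_def n_def)
    qed
    have e: "E M = c * (t * \<tau>) * f / (2 * pi * g) * p * u"
      by (simp add: E_def t_def f_def p_def u_def g_def)
    have x: "X (Suc M) = c * ((n + 2) * f) * (t * \<tau> ^ 4) / (2 * pi * ((n + 2 + \<nu>) * ((n + 1 + \<nu>) * g))) * ((n + 2 + \<nu>) / \<tau>) * v"
    proof -
      have "2 * real (Suc M) + 1 + \<nu> = 2 * real M + 3 + \<nu>" "2 * real (Suc M) + \<nu> = 2 * real M + 2 + \<nu>"
        "2 * Suc M = 2 * M + 2" "2 * int (Suc M) = 2 * int M + 2" "4 * Suc M = 4 * M + 4" by simp_all
      then show ?thesis unfolding X_def by (simp only: g2 f1 power_add t_def v_def n_def)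
    qed
    show ?thesis
      unfolding b e x p_def[symmetric] using pos \<open>g > 0\<close> \<open>\<tau> > 0\<close>
      by (simp add: divide_simps) (simp add: algebra_simps power2_eq_square power4_eq_xxxx)
  qed
  have "(\<Sum>j<Suc M. T j) = (\<Sum>k<2 * M + 1. b k) / pi - E M"
  proof (induction M)
    case 0
    then show ?case using T[of 0] assms by simp
  next
    case (Suc M)
    have "(\<Sum>k<2 * Suc M + 1. b k) / pi = (\<Sum>k<2 * M + 1. b k) / pi + b (2 * M + 1) / pi + b (2 * Suc M) / pi"
      by (simp add: add_divide_distrib)
    moreover have "T (Suc M) = b (2 * Suc M) / pi - E (Suc M) + \<phi> (2 * int M + 1) * X (Suc M)"
      using T[of "Suc M"] by (simp add: add.commute)
    ultimately show ?case
      unfolding sum.lessThan_Suc[of T "Suc M"] Suc.IH using odd[of M] by linarith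
  qed
  then show ?thesis by (simp only: T_def b_def E_def)
qed

section \<open>The expansion of the kernel\<close>

text \<open>
  The bracket has the shape of the recurrence in \<open>integral_sgn_weight_laguerre\<close>.
\<close>

lemma p_odd_eq:
  assumes "\<tau> > 0"
  shows "p_odd \<nu> \<tau> j x = - (\<tau> ^ (2 * j) * fact (2 * j))
    * (\<tau> * (2 * real j + 1) * laguerre \<nu> (2 * int j + 1) (x / \<tau>)
       - (2 * real j + \<nu>) / \<tau> * laguerre \<nu> (2 * int j - 1) (x / \<tau>))"
proof -
  have "\<tau> powi (2 * int j - 1) = \<tau> ^ (2 * j) / \<tau>"
    using assms power_int_diff[of \<tau> "2 * int j" 1] power_int_of_nat[of \<tau> "2 * j"] by simp
  note pw = this
  show ?thesis unfolding p_odd_def pw using assms by (simp add: field_simps)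
qed

theorem theorem2p1:
  fixes N :: nat and \<tau> \<nu> x y :: real
  assumes "even N" and "N > 0" and "0 < \<tau>" and "\<tau> < 1" and "\<nu> > -1"
    and "x \<noteq> 0" and "y \<noteq> 0"
  shows "S_N \<nu> \<tau> N x y = S_N1 \<nu> \<tau> N x y + S_N1_tilde \<nu> \<tau> N x y + S_N2 \<nu> \<tau> N x y"
proof -
  obtain M where N: "N = 2 * Suc M"
    using assms(1,2) by (metis dvdE gr0_implies_Suc nat_0_less_mult_iff)
  define c where "c = 1 / (1 - \<tau>\<^sup>2)"
  have "\<tau>\<^sup>2 < 1" using assms(3,4) by (simp add: power_less_one_iff)
  then have "c > 0" by (simp add: c_def)
  define w where "w = weight \<nu> \<tau>"
  define \<phi> where "\<phi> i = laguerre \<nu> i (x / \<tau>)" for i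
  define \<psi> where "\<psi> i = (LBINT v. sgn (y - v) * (w v * laguerre \<nu> i (v / \<tau>)))" for i
  define K\<^sub>1 where "K\<^sub>1 = \<bar>y\<bar> powr (\<nu> / 2) * \<bar>y\<bar> * bessel_K (\<nu> / 2 + 1) (\<bar>y\<bar> / (1 - \<tau>\<^sup>2)) * exp (\<tau> * c * y)"
  define l' where "l' i = poly (pderiv (laguerre_poly \<nu> i)) (y / \<tau>) / \<tau>" for i
  define H where "H i = (c * K\<^sub>1 + \<tau> * c * (y * w y)) * laguerre \<nu> i (y / \<tau>) + y * w y * l' i" for i
  have int: "integrable lborel (\<lambda>v. sgn (y - v) * (w v * laguerre \<nu> i (v / \<tau>)))" for i
    unfolding w_def by (rule integrable_sgn_weight_laguerre[OF assms(5,3,4) c_def])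
  have H: "2 * H i = c * (\<tau> * (of_int i + 1) * \<psi> (i + 1) - (of_int i + \<nu>) / \<tau> * \<psi> (i - 1))" if "i \<ge> 0" for i
    using integral_sgn_weight_laguerre[OF assms(5,3,4) c_def that assms(7)]
    by (simp add: H_def K\<^sub>1_def l'_def w_def \<psi>_def)

  have Phi_even: "Phi \<nu> \<tau> (2 * j) y = \<tau> ^ (2 * j) * fact (2 * j) * \<psi> (2 * int j)" for j
  proof -
    have "Phi \<nu> \<tau> (2 * j) y
      = (LBINT v. (\<tau> ^ (2 * j) * fact (2 * j)) * (sgn (y - v) * (w v * laguerre \<nu> (2 * int j) (v / \<tau>))))"
      unfolding Phi_def
      by (rule arg_cong[where f = "integral\<^sup>L lborel"]) (simp add: fun_eq_iff p_poly_def p_even_def w_def mult_ac)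
    then show ?thesis by (simp add: \<psi>_def)
  qed
  have Phi_odd: "Phi \<nu> \<tau> (2 * j + 1) y = - (\<tau> ^ (2 * j) * fact (2 * j)) * (2 / c * H (2 * int j))" for j
  proof -
    let ?h = "\<lambda>i v. sgn (y - v) * (w v * laguerre \<nu> i (v / \<tau>))"
    have "Phi \<nu> \<tau> (2 * j + 1) y = (LBINT v. - (\<tau> ^ (2 * j) * fact (2 * j))
        * (\<tau> * (2 * real j + 1) * ?h (2 * int j + 1) v - (2 * real j + \<nu>) / \<tau> * ?h (2 * int j - 1) v))"
      unfolding Phi_def
      by (rule arg_cong[where f = "integral\<^sup>L lborel"])
        (simp add: fun_eq_iff p_poly_def p_odd_eq[OF assms(3)] w_def algebra_simps)
    also have "\<dots> = - (\<tau> ^ (2 * j) * fact (2 * j))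
        * (\<tau> * (2 * real j + 1) * \<psi> (2 * int j + 1) - (2 * real j + \<nu>) / \<tau> * \<psi> (2 * int j - 1))"
      unfolding \<psi>_def using int by simp
    also have "\<tau> * (2 * real j + 1) * \<psi> (2 * int j + 1) - (2 * real j + \<nu>) / \<tau> * \<psi> (2 * int j - 1)
      = 2 / c * H (2 * int j)"
      using H[of "2 * int j"] \<open>c > 0\<close> by (simp add: field_simps)
    finally show ?thesis .
  qed

  have summand: "(p_poly \<nu> \<tau> (2 * j + 1) x * Phi \<nu> \<tau> (2 * j) y - p_poly \<nu> \<tau> (2 * j) x * Phi \<nu> \<tau> (2 * j + 1) y)
        / r_const \<nu> \<tau> j
    = c * fact (2 * j) * \<tau> ^ (4 * j) / (2 * pi * Gamma (2 * real j + 1 + \<nu>))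
      * (2 / c * \<phi> (2 * int j) * H (2 * int j)
         - (\<tau> * (2 * real j + 1) * \<phi> (2 * int j + 1) - (2 * real j + \<nu>) / \<tau> * \<phi> (2 * int j - 1)) * \<psi> (2 * int j))"
    for j
  proof -
    define g where "g = Gamma (2 * real j + 1 + \<nu>)"
    have "g > 0" unfolding g_def using assms by (intro Gamma_real_pos) auto
    define q where "q = \<tau> ^ (2 * j) * fact (2 * j)"
    define a where "a = \<tau> * (2 * real j + 1) * \<phi> (2 * int j + 1) - (2 * real j + \<nu>) / \<tau> * \<phi> (2 * int j - 1)"
    have "r_const \<nu> \<tau> j = 2 * pi / c * fact (2 * j) * g"
      using Gamma_fact[of "2 * j", where 'a = real] by (simp add: r_const_def g_def c_def add.commute)
    moreover have "p_poly \<nu> \<tau> (2 * j + 1) x = - q * a" "p_poly \<nu> \<tau> (2 * j) x = q * \<phi> (2 * int j)"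
      by (simp_all add: p_poly_def p_odd_eq[OF assms(3)] p_even_def q_def a_def \<phi>_def)
    moreover have "q * q = fact (2 * j) * (fact (2 * j) * \<tau> ^ (4 * j))"
      by (simp add: q_def power_add[symmetric] mult_ac)
    moreover have "(- q * a * (q * \<psi> (2 * int j)) - q * \<phi> (2 * int j) * (- q * (2 / c * H (2 * int j))))
      = q * q * (2 / c * \<phi> (2 * int j) * H (2 * int j) - a * \<psi> (2 * int j))"
      by (simp add: algebra_simps)
    ultimately show ?thesis
      unfolding Phi_even Phi_odd q_def[symmetric] a_def[symmetric] g_def[symmetric]
      using \<open>g > 0\<close> \<open>c > 0\<close> by (simp only:) (simp add: field_simps)
  qed
  define k where "k i = fact i * \<tau> ^ (2 * i) / Gamma (real i + \<nu> + 1) * \<phi> (int i)" for i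
  have S_N: "S_N \<nu> \<tau> N x y = w x * ((\<Sum>i<N - 1. k i * H (int i)) / pi
      - c * \<tau> ^ (4 * M + 1) * fact (2 * M + 1) / (2 * pi * Gamma (2 * real M + 1 + \<nu>)) * \<phi> (2 * int M + 1) * \<psi> (2 * int M))"
  proof -
    have "\<phi> (- 1) = 0" by (simp add: \<phi>_def laguerre_def)
    moreover have "N div 2 = Suc M" "N - 1 = 2 * M + 1" using N by simp_all
    ultimately show ?thesis
      unfolding S_N_def summand k_def w_def
      by (simp only: laguerre_skew_sum_telescopes[OF assms(5,3) \<open>c > 0\<close> _ H])
  qed

  have wx: "\<bar>x\<bar> powr (\<nu> / 2) * bessel_K (\<nu> / 2) (\<bar>x\<bar> / (1 - \<tau>\<^sup>2)) * exp (\<tau> / (1 - \<tau>\<^sup>2) * x) = w x" for x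
    by (simp add: w_def weight_def)
  have xy: "\<bar>x * y\<bar> powr (\<nu> / 2) = \<bar>x\<bar> powr (\<nu> / 2) * \<bar>y\<bar> powr (\<nu> / 2)"
    by (simp add: abs_mult powr_mult)
  have S1: "S_N1 \<nu> \<tau> N x y = w x * ((c * K\<^sub>1 + \<tau> * c * (y * w y)) * (\<Sum>i<N - 1. k i * laguerre \<nu> (int i) (y / \<tau>))) / pi"
    unfolding S_N1_def xy kernel_K_def wx[symmetric, of x] wx[symmetric, of y] K\<^sub>1_def k_def \<phi>_def
    by (simp add: c_def add_divide_distrib algebra_simps)
  have deriv: "deriv (\<lambda>u. kernel_K \<nu> \<tau> (N - 1) x u) y = (\<Sum>i<N - 1. k i * l' (int i))"
  proof (rule DERIV_imp_deriv)
    have "((\<lambda>u. laguerre \<nu> i (u / \<tau>)) has_real_derivative l' i) (at y)" for i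
      unfolding poly_laguerre_poly[symmetric] l'_def
      by (rule DERIV_chain2[OF poly_DERIV, THEN DERIV_cong]) (use assms in \<open>auto intro!: derivative_eq_intros\<close>)
    then show "((\<lambda>u. kernel_K \<nu> \<tau> (N - 1) x u) has_real_derivative (\<Sum>i<N - 1. k i * l' (int i))) (at y)"
      unfolding kernel_K_def k_def \<phi>_def by (intro DERIV_sum DERIV_cmult)
  qed
  have S1': "S_N1_tilde \<nu> \<tau> N x y = w x * (y * w y * (\<Sum>i<N - 1. k i * l' (int i))) / pi"
  proof -
    have "exp (\<tau> / (1 - \<tau>\<^sup>2) * (x + y)) = exp (\<tau> / (1 - \<tau>\<^sup>2) * x) * exp (\<tau> / (1 - \<tau>\<^sup>2) * y)"
      by (simp add: exp_add[symmetric] distrib_left)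
    then show ?thesis unfolding S_N1_tilde_def xy deriv wx[symmetric, of x] wx[symmetric, of y] by simp
  qed
  have S2: "S_N2 \<nu> \<tau> N x y
    = - w x * (c * \<tau> ^ (4 * M + 1) * fact (2 * M + 1) / (2 * pi * Gamma (2 * real M + 1 + \<nu>)) * \<phi> (2 * int M + 1) * \<psi> (2 * int M))"
  proof -
    \<comment> \<open>The factor \<open>1/2 - 1\<^bsub>t<y\<^esub>\<close> equals \<open>- sgn (y - t) / 2\<close> off the point \<open>t = y\<close>.\<close>
    have "(LBINT t. (1 / 2 - indicator {..<y} t) * \<bar>t\<bar> powr (\<nu> / 2)
          * bessel_K (\<nu> / 2) (\<bar>t\<bar> / (1 - \<tau>\<^sup>2)) * exp (\<tau> / (1 - \<tau>\<^sup>2) * t) * laguerre \<nu> (int N - 2) (t / \<tau>))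
      = (LBINT t. - 1 / 2 * (sgn (y - t) * (w t * laguerre \<nu> (2 * int M) (t / \<tau>))))"
      using N by (intro integral_discrete_difference[of "{y}"]) (auto simp: wx[symmetric] indicator_def sgn_real_def)
    also have "\<dots> = - \<psi> (2 * int M) / 2" by (simp add: \<psi>_def)
    finally have "S_N2 \<nu> \<tau> N x y = 1 / pi * (\<tau> ^ (2 * N - 3) * c) * (fact (N - 1) / Gamma (real N + \<nu> - 1))
        * w x * laguerre \<nu> (int N - 1) (x / \<tau>) * (- \<psi> (2 * int M) / 2)"
      unfolding S_N2_def wx[symmetric, of x] by (simp only: c_def) (simp add: mult_ac)
    moreover have "2 * N - 3 = 4 * M + 1" "N - 1 = 2 * M + 1" "real N + \<nu> - 1 = 2 * real M + 1 + \<nu>"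
      "int N - 1 = 2 * int M + 1" using N by simp_all
    ultimately show ?thesis by (simp only: \<phi>_def) (simp add: mult_ac)
  qed
  have "(\<Sum>i<N - 1. k i * H (int i)) = (c * K\<^sub>1 + \<tau> * c * (y * w y)) * (\<Sum>i<N - 1. k i * laguerre \<nu> (int i) (y / \<tau>))
      + y * w y * (\<Sum>i<N - 1. k i * l' (int i))"
    unfolding H_def by (simp add: sum_distrib_left sum.distrib[symmetric] algebra_simps)
  then show ?thesis unfolding S_N S1 S1' S2 by (simp add: add_divide_distrib algebra_simps)
qed

end
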